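(* The assignment $\mathcal{S}^{\mathrm{MC}}_{\to}\colon\mathbf{roMC}\to\mathbb{S}^{\mathrm{MC}}_{\to}$, identity on objects and sending a rightward open Markov chain $\mathcal C\colon m\to n$ to the arrow $\mathcal{S}^{\mathrm{MC}}_{\to}(\mathcal C)\colon m\to n$ given by $\mathcal{S}^{\mathrm{MC}}_{\to}(\mathcal C)(i,j)=(\mathrm{RPr}^{\mathcal C}_{i,j},\mathrm{ERw}^{\mathcal C}_{i,j})$, is a traced symmetric monoidal functor. That is, $\mathcal{S}^{\mathrm{MC}}_{\to}(\mathcal C;\mathcal D)=\mathcal{S}^{\mathrm{MC}}_{\to}(\mathcal C);\mathcal{S}^{\mathrm{MC}}_{\to}(\mathcal D)$, $\mathcal{S}^{\mathrm{MC}}_{\to}(\mathcal C\oplus\mathcal D)=\mathcal{S}^{\mathrm{MC}}_{\to}(\mathcal C)\oplus\mathcal{S}^{\mathrm{MC}}_{\to}(\mathcal D)$, and $\mathcal{S}^{\mathrm{MC}}_{\to}(\mathrm{tr}^l_{m,n}(\mathcal E))=\mathrm{tr}^l_{m,n}(\mathcal{S}^{\mathrm{MC}}_{\to}(\mathcal E))$ for all roMCs of appropriate types (and identities and swaps are preserved).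
   Context: Notation: $[k]=\{1,\dots,k\}$, $[a,b]=\{a,\dots,b\}$, $+$ disjoint union. A rightward open Markov chain (roMC) $\mathcal C\colon m\to n$ is $(m,n,Q,E,P,R)$: $Q$ finite set of positions; $E\colon[m]\to Q+[n]$; $P\colon Q\times(Q+[n])\to\mathbb R_{\ge0}$ with $\sum_{s'}P(s,s')\in\{0,1\}$; $R\colon Q\to\mathbb R_{\ge0}$; distinct elements of $[m]+Q$ have disjoint sets of immediately reachable exits. $\mathbf{roMC}$ has objects natural numbers and arrows isomorphism classes of roMCs (bijections of positions preserving $E,P,R$). Operations: sequential composition $\mathcal C;\mathcal D$ (positions $Q^{\mathcal C}+Q^{\mathcal D}$; $E(i)=E^{\mathcal C}(i)$ if a position, else $E^{\mathcal D}(E^{\mathcal C}(i))$; from $s\in Q^{\mathcal C}$, probabilities into $Q^{\mathcal C}$ are $P^{\mathcal C}$ and into $s'\in Q^{\mathcal D}+[n]$ are $\sum_kP^{\mathcal C}(s,k)[E^{\mathcal D}(k)=s']$; from $Q^{\mathcal D}$ as in $\mathcal D$); sum $\oplus$ (disjoint juxtaposition, second component's entrances/exits shifted); identities and swaps (positionless, $E(i)=i$, resp. $E(i)=i+n$ for $i\le m$ and $i-m$ for $i>m$ in $\mathcal S_{m,n}\colon m+n\to n+m$); trace $\mathrm{tr}^l_{m,n}(\mathcal E)$ for $\mathcal E\colon l+m\to l+n$: positions $Q^{\mathcal E}$, rewards $R^{\mathcal E}$, exits in $[l]$ fed back to entrances in $[l]$: $E(i)$ follows $i+l,E^{\mathcal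 E}(i+l),\dots$ until first leaving $[l]$, landing at $t$, and is $t-l$ if $t$ an exit else $t$; $P(q,q')=P^{\mathcal E}(q,q'+l)+\sum_{i\in\mathrm{prec}(q'+l)}P^{\mathcal E}(q,i)$ for $q'\in[n]$, $P(q,q')=P^{\mathcal E}(q,q')+\sum_{i\in\mathrm{prec}(q')}P^{\mathcal E}(q,i)$ for $q'\in Q^{\mathcal E}$, where $\mathrm{prec}(t)$ is the set of $i\in[l]$ whose chain $i,E^{\mathcal E}(i),\dots$ stays in $[l]$ until reaching $t\in[l+1,l+n]+Q^{\mathcal E}$. Paths, $\mathrm{RPr}$, $\mathrm{ERw}$: a path from entrance $i$ to exit $j$ is $i,s_1,\dots,s_k,j$ with first element after $i$ equal to $E(i)$, probability $\prod_tP(s_t,s_{t+1})$ ($s_{k+1}=j$), reward $\sum_tR(s_t)$; $\mathrm{RPr}_{i,j}$ is the total probability and $\mathrm{ERw}_{i,j}$ the sum of probability times reward over all such paths. $\mathbb{S}^{\mathrm{MC}}_{\to}$: objects natural numbers; an arrow $f\colon m\to n$ assigns to each $(i,j)\in[m]\times[n]$ a pair $(p_{i,j},r_{i,j})\in\mathbb R_{\ge0}^2$ with $\sum_jp_{i,j}\le1$ and $p_{i,j}=0\Rightarrow r_{i,j}=0$. Composition: $P^{f;g}=P^fP^g$, $R^{f;g}=P^fR^g+R^fP^g$ (matrices $P^f=[p^f_{i,k}]$, $R^f=[r^f_{i,k}]$). $f\oplus g$ block-diagonal with $(0,0)$ off-blocks; identity $(\delta_{ij},0)$; swap $m+n\to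 n+m$ with $(1,0)$ at $(i,i+n)$, $i\le m$, and $(i,i-m)$, $i>m$, else $(0,0)$. Trace of $h\colon l+m\to l+n$: $p^{\mathrm{tr}(h)}_{i,j}=p^h_{l+i,l+j}+\sum_{d\in\mathbb N}(A_pB_p^dC_p)_{i,j}$, $r^{\mathrm{tr}(h)}_{i,j}=r^h_{l+i,l+j}+\sum_d(AB^dC)_{i,j}$, where $A_p=[p^h_{l+i,k}]_{i\in[m],k\in[l]}$, $B_p=[p^h_{k,k'}]_{k,k'\in[l]}$, $C_p=[p^h_{k',l+j}]_{k'\in[l],j\in[n]}$, $A_r,B_r,C_r$ the same with $r^h$, $A=(A_p\ A_r)$, $B=\begin{pmatrix}B_p&B_r\\0&B_p\end{pmatrix}$, $C=\begin{pmatrix}C_r\\C_p\end{pmatrix}$. *)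

theory Defs
  imports
    "HOL-Analysis.Infinite_Sum"
    "HOL-Library.Disjoint_Sets"
    "Jordan_Normal_Form.Matrix"
begin

text \<open>
  Indices are 0-based throughout: the set \<open>[k] = {1,\<dots>,k}\<close> is rendered as \<open>{..<k}\<close>.
\<close>

section \<open>Rightward open Markov chains\<close>

text \<open>
  An element of \<open>Q + [n]\<close> is \<open>Inl q\<close> (a position) or \<open>Inr j\<close> (an exit). The values of the
  functions outside the sets \<open>[m]\<close>, \<open>Q\<close> and \<open>Q + [n]\<close> carry no information.
\<close>

record 'q omc =
  ins :: nat
  outs :: nat
  pos :: "'q set"
  entr :: "nat \<Rightarrow> 'q + nat"
  prob :: "'q \<Rightarrow> 'q + nat \<Rightarrow> real"
  rwd :: "'q \<Rightarrow> real"

definition targets :: "'q omc \<Rightarrow> ('q + nat) set" where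
  "targets C = pos C <+> {..<outs C}"

text \<open>The exits immediately reachable from an element of \<open>[m] + Q\<close>.\<close>

fun imm_exits :: "'q omc \<Rightarrow> nat + 'q \<Rightarrow> nat set" where
  "imm_exits C (Inl i) = {j. j < outs C \<and> entr C i = Inr j}"
| "imm_exits C (Inr q) = {j. j < outs C \<and> prob C q (Inr j) > 0}"

definition romc :: "nat \<Rightarrow> nat \<Rightarrow> 'q omc \<Rightarrow> bool" where
  "romc m n C \<longleftrightarrow>
     ins C = m \<and> outs C = n \<and> finite (pos C) \<and>
     (\<forall>i<m. entr C i \<in> targets C) \<and>
     (\<forall>q\<in>pos C. \<forall>s\<in>targets C. prob C q s \<ge> 0) \<and>
     (\<forall>q\<in>pos C. (\<Sum>s\<in>targets C. prob C q s) \<in> {0, 1}) \<and>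
     (\<forall>q\<in>pos C. rwd C q \<ge> 0) \<and>
     disjoint_family_on (imm_exits C) ({..<m} <+> pos C)"

definition romc_iso :: "'q omc \<Rightarrow> 'r omc \<Rightarrow> bool" where
  "romc_iso C D \<longleftrightarrow>
     ins C = ins D \<and> outs C = outs D \<and>
     (\<exists>f. bij_betw f (pos C) (pos D) \<and>
        (\<forall>i<ins C. entr D i = map_sum f id (entr C i)) \<and>
        (\<forall>q\<in>pos C. \<forall>s\<in>targets C. prob D (f q) (map_sum f id s) = prob C q s) \<and>
        (\<forall>q\<in>pos C. rwd D (f q) = rwd C q))"

definition seq_romc :: "'q omc \<Rightarrow> 'r omc \<Rightarrow> ('q + 'r) omc" where
  "seq_romc C D =
     \<lparr>ins = ins C, outs = outs D, pos = pos C <+> pos D,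
      entr = (\<lambda>i. case entr C i of
                Inl q \<Rightarrow> Inl (Inl q)
              | Inr k \<Rightarrow> map_sum Inr id (entr D k)),
      prob = (\<lambda>u s. case u of
                Inl q \<Rightarrow> (case s of
                    Inl (Inl q') \<Rightarrow> prob C q (Inl q')
                  | Inl (Inr r') \<Rightarrow>
                      (\<Sum>k<outs C. prob C q (Inr k) * of_bool (entr D k = Inl r'))
                  | Inr j \<Rightarrow> (\<Sum>k<outs C. prob C q (Inr k) * of_bool (entr D k = Inr j)))
              | Inr r \<Rightarrow> (case s of
                    Inl (Inl q') \<Rightarrow> 0
                  | Inl (Inr r') \<Rightarrow> prob D r (Inl r')
                  | Inr j \<Rightarrow> prob D r (Inr j))),
      rwd = case_sum (rwd C) (rwd D)\<rparr>"

definition sum_romc :: "'q omc \<Rightarrow> 'r omc \<Rightarrow> ('q + 'r) omc" where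
  "sum_romc C D =
     \<lparr>ins = ins C + ins D, outs = outs C + outs D, pos = pos C <+> pos D,
      entr = (\<lambda>i. if i < ins C then map_sum Inl id (entr C i)
                  else map_sum Inr (\<lambda>j. j + outs C) (entr D (i - ins C))),
      prob = (\<lambda>u s. case u of
                Inl q \<Rightarrow> (case s of
                    Inl (Inl q') \<Rightarrow> prob C q (Inl q')
                  | Inl (Inr r') \<Rightarrow> 0
                  | Inr j \<Rightarrow> if j < outs C then prob C q (Inr j) else 0)
              | Inr r \<Rightarrow> (case s of
                    Inl (Inl q') \<Rightarrow> 0
                  | Inl (Inr r') \<Rightarrow> prob D r (Inl r')
                  | Inr j \<Rightarrow> if j < outs C then 0 else prob D r (Inr (j - outs C)))),
      rwd = case_sum (rwd C) (rwd D)\<rparr>"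

definition id_romc :: "nat \<Rightarrow> 'q omc" where
  "id_romc n = \<lparr>ins = n, outs = n, pos = {}, entr = Inr, prob = (\<lambda>_ _. 0), rwd = (\<lambda>_. 0)\<rparr>"

definition swap_romc :: "nat \<Rightarrow> nat \<Rightarrow> 'q omc" where
  "swap_romc m n =
     \<lparr>ins = m + n, outs = n + m, pos = {},
      entr = (\<lambda>i. Inr (if i < m then i + n else i - m)),
      prob = (\<lambda>_ _. 0), rwd = (\<lambda>_. 0)\<rparr>"

text \<open>
  \<open>lands C l i t\<close>: the chain \<open>i, E i, E (E i), \<dots>\<close>, in which exits in \<open>[l]\<close> are read as entrances
  in \<open>[l]\<close>, first leaves \<open>[l]\<close> (after at least one step) at \<open>t\<close>.
\<close>

inductive lands :: "'q omc \<Rightarrow> nat \<Rightarrow> nat \<Rightarrow> 'q + nat \<Rightarrow> bool" for C l where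
  stop: "entr C i = t \<Longrightarrow> t \<notin> Inr ` {..<l} \<Longrightarrow> lands C l i t"
| step: "entr C i = Inr k \<Longrightarrow> k < l \<Longrightarrow> lands C l k t \<Longrightarrow> lands C l i t"

definition prec :: "'q omc \<Rightarrow> nat \<Rightarrow> 'q + nat \<Rightarrow> nat set" where
  "prec C l t = {i. i < l \<and> lands C l i t}"

text \<open>
  For a roMC, an entrance outside \<open>[l]\<close> always lands somewhere: a loop inside \<open>[l]\<close> that can be
  entered from outside would give one of its exits two accesses.
\<close>

definition trace_romc :: "nat \<Rightarrow> nat \<Rightarrow> nat \<Rightarrow> 'q omc \<Rightarrow> 'q omc" where
  "trace_romc l m n C =
     \<lparr>ins = m, outs = n, pos = pos C,
      entr = (\<lambda>i. map_sum id (\<lambda>t. t - l) (THE t. lands C l (i + l) t)),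
      prob = (\<lambda>q s. case s of
                Inl q' \<Rightarrow> prob C q (Inl q') + (\<Sum>i\<in>prec C l (Inl q'). prob C q (Inr i))
              | Inr j \<Rightarrow> prob C q (Inr (j + l)) + (\<Sum>i\<in>prec C l (Inr (j + l)). prob C q (Inr i))),
      rwd = rwd C\<rparr>"


section \<open>Reachability probability and expected reward\<close>

text \<open>
  A path \<open>i, s\<^sub>1, \<dots>, s\<^sub>k, j\<close> (with \<open>k \<ge> 0\<close>) is represented by the list \<open>[s\<^sub>1, \<dots>, s\<^sub>k]\<close>;
  \<open>path_tail\<close> is the sequence \<open>s\<^sub>1, \<dots>, s\<^sub>k, j\<close> of its elements after \<open>i\<close>.
\<close>

definition path_tail :: "'q list \<Rightarrow> nat \<Rightarrow> ('q + nat) list" where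
  "path_tail ss j = map Inl ss @ [Inr j]"

definition paths :: "'q omc \<Rightarrow> nat \<Rightarrow> nat \<Rightarrow> 'q list set" where
  "paths C i j = {ss. set ss \<subseteq> pos C \<and> hd (path_tail ss j) = entr C i}"

definition path_prob :: "'q omc \<Rightarrow> nat \<Rightarrow> 'q list \<Rightarrow> real" where
  "path_prob C j ss = (\<Prod>t<length ss. prob C (ss ! t) (path_tail ss j ! Suc t))"

definition path_rwd :: "'q omc \<Rightarrow> 'q list \<Rightarrow> real" where
  "path_rwd C ss = (\<Sum>t<length ss. rwd C (ss ! t))"

definition RPr :: "'q omc \<Rightarrow> nat \<Rightarrow> nat \<Rightarrow> real" where
  "RPr C i j = (\<Sum>\<^sub>\<infinity>ss\<in>paths C i j. path_prob C j ss)"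

definition ERw :: "'q omc \<Rightarrow> nat \<Rightarrow> nat \<Rightarrow> real" where
  "ERw C i j = (\<Sum>\<^sub>\<infinity>ss\<in>paths C i j. path_prob C j ss * path_rwd C ss)"


section \<open>Operations on matrix pairs\<close>

text \<open>
  An arrow \<open>f\<close> with values \<open>(p\<^sub>i\<^sub>j, r\<^sub>i\<^sub>j)\<close> is the pair of the matrices \<open>P\<^sup>f\<close> and \<open>R\<^sup>f\<close>.
\<close>

type_synonym smc = "real mat \<times> real mat"

definition smc_hom :: "nat \<Rightarrow> nat \<Rightarrow> smc set" where
  "smc_hom m n = {(P, R).
     P \<in> carrier_mat m n \<and> R \<in> carrier_mat m n \<and>
     (\<forall>i<m. \<forall>j<n. P $$ (i, j) \<ge> 0 \<and> R $$ (i, j) \<ge> 0) \<and>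
     (\<forall>i<m. (\<Sum>j<n. P $$ (i, j)) \<le> 1) \<and>
     (\<forall>i<m. \<forall>j<n. P $$ (i, j) = 0 \<longrightarrow> R $$ (i, j) = 0)}"

definition smc_seq :: "smc \<Rightarrow> smc \<Rightarrow> smc" where
  "smc_seq f g = (fst f * fst g, fst f * snd g + snd f * fst g)"

definition block_diag :: "real mat \<Rightarrow> real mat \<Rightarrow> real mat" where
  "block_diag X Y =
     four_block_mat X (0\<^sub>m (dim_row X) (dim_col Y)) (0\<^sub>m (dim_row Y) (dim_col X)) Y"

definition smc_sum :: "smc \<Rightarrow> smc \<Rightarrow> smc" where
  "smc_sum f g = (block_diag (fst f) (fst g), block_diag (snd f) (snd g))"

definition smc_id :: "nat \<Rightarrow> smc" where
  "smc_id n = (1\<^sub>m n, 0\<^sub>m n n)"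

definition smc_swap :: "nat \<Rightarrow> nat \<Rightarrow> smc" where
  "smc_swap m n =
     (mat (m + n) (n + m) (\<lambda>(i, j). if j = (if i < m then i + n else i - m) then 1 else 0),
      0\<^sub>m (m + n) (n + m))"

definition blkA :: "nat \<Rightarrow> nat \<Rightarrow> real mat \<Rightarrow> real mat" where
  "blkA l m X = mat m l (\<lambda>(i, k). X $$ (l + i, k))"

definition blkB :: "nat \<Rightarrow> real mat \<Rightarrow> real mat" where
  "blkB l X = mat l l (\<lambda>(k, k'). X $$ (k, k'))"

definition blkC :: "nat \<Rightarrow> nat \<Rightarrow> real mat \<Rightarrow> real mat" where
  "blkC l n X = mat l n (\<lambda>(k, j). X $$ (k, l + j))"

definition tr_term_p :: "nat \<Rightarrow> nat \<Rightarrow> nat \<Rightarrow> smc \<Rightarrow> nat \<Rightarrow> real mat" where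
  "tr_term_p l m n h d = blkA l m (fst h) * blkB l (fst h) ^\<^sub>m d * blkC l n (fst h)"

text \<open>The summand \<open>A B\<^sup>d C\<close>; the row block \<open>A = (A\<^sub>p A\<^sub>r)\<close> is written with empty lower blocks.\<close>

definition tr_term_r :: "nat \<Rightarrow> nat \<Rightarrow> nat \<Rightarrow> smc \<Rightarrow> nat \<Rightarrow> real mat" where
  "tr_term_r l m n h d =
     four_block_mat (blkA l m (fst h)) (blkA l m (snd h)) (0\<^sub>m 0 l) (0\<^sub>m 0 l)
     * four_block_mat (blkB l (fst h)) (blkB l (snd h)) (0\<^sub>m l l) (blkB l (fst h)) ^\<^sub>m d
     * (blkC l n (snd h) @\<^sub>r blkC l n (fst h))"

definition smc_trace :: "nat \<Rightarrow> nat \<Rightarrow> nat \<Rightarrow> smc \<Rightarrow> smc" where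
  "smc_trace l m n h =
     (mat m n (\<lambda>(i, j). fst h $$ (l + i, l + j) + (\<Sum>d. tr_term_p l m n h d $$ (i, j))),
      mat m n (\<lambda>(i, j). snd h $$ (l + i, l + j) + (\<Sum>d. tr_term_r l m n h d $$ (i, j))))"


section \<open>The two categories and the functor\<close>

text \<open>
  The data of a (strict) traced symmetric monoidal category whose objects are the natural numbers,
  with addition as the monoidal product on objects.
\<close>

record 'a tsm_data =
  Hom :: "nat \<Rightarrow> nat \<Rightarrow> 'a set"
  Ident :: "nat \<Rightarrow> 'a"
  Seq :: "'a \<Rightarrow> 'a \<Rightarrow> 'a"
  Tensor :: "'a \<Rightarrow> 'a \<Rightarrow> 'a"
  Swap :: "nat \<Rightarrow> nat \<Rightarrow> 'a"
  Tr :: "nat \<Rightarrow> nat \<Rightarrow> nat \<Rightarrow> 'a \<Rightarrow> 'a"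

definition traced_sm_functor :: "'a tsm_data \<Rightarrow> 'b tsm_data \<Rightarrow> ('a \<Rightarrow> 'b) \<Rightarrow> bool" where
  "traced_sm_functor \<A> \<B> F \<longleftrightarrow>
     (\<forall>m n. \<forall>x\<in>Hom \<A> m n. F x \<in> Hom \<B> m n) \<and>
     (\<forall>n. F (Ident \<A> n) = Ident \<B> n) \<and>
     (\<forall>m n k. \<forall>x\<in>Hom \<A> m n. \<forall>y\<in>Hom \<A> n k. F (Seq \<A> x y) = Seq \<B> (F x) (F y)) \<and>
     (\<forall>m n m' n'. \<forall>x\<in>Hom \<A> m n. \<forall>y\<in>Hom \<A> m' n'.
        F (Tensor \<A> x y) = Tensor \<B> (F x) (F y)) \<and>
     (\<forall>m n. F (Swap \<A> m n) = Swap \<B> m n) \<and>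
     (\<forall>l m n. \<forall>x\<in>Hom \<A> (l + m) (l + n). F (Tr \<A> l m n x) = Tr \<B> l m n (F x))"

text \<open>
  As position sets are finite, an isomorphism class, for chains with positions of any type, is
  determined by its members with positions in \<^typ>\<open>nat\<close>. The operations on classes collect the
  results over all representatives; isomorphic representatives have isomorphic results, so each
  union below is a single class.
\<close>

definition iso_class :: "'q omc \<Rightarrow> nat omc set" where
  "iso_class C = {D. romc_iso C D}"

definition roMC :: "nat omc set tsm_data" where
  "roMC =
     \<lparr>Hom = (\<lambda>m n. {iso_class C | C :: nat omc. romc m n C}),
      Ident = (\<lambda>n. iso_class (id_romc n :: nat omc)),
      Seq = (\<lambda>X Y. \<Union>C\<in>X. \<Union>D\<in>Y. iso_class (seq_romc C D)),
      Tensor = (\<lambda>X Y. \<Union>C\<in>X. \<Union>D\<in>Y. iso_class (sum_romc C D)),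
      Swap = (\<lambda>m n. iso_class (swap_romc m n :: nat omc)),
      Tr = (\<lambda>l m n X. \<Union>C\<in>X. iso_class (trace_romc l m n C))\<rparr>"

definition SMC :: "smc tsm_data" where
  "SMC = \<lparr>Hom = smc_hom, Ident = smc_id, Seq = smc_seq, Tensor = smc_sum, Swap = smc_swap,
          Tr = smc_trace\<rparr>"

definition sem :: "'q omc \<Rightarrow> smc" where
  "sem C = (mat (ins C) (outs C) (\<lambda>(i, j). RPr C i j), mat (ins C) (outs C) (\<lambda>(i, j). ERw C i j))"

text \<open>The map induced by \<^const>\<open>sem\<close> on isomorphism classes.\<close>

definition sem_MC :: "nat omc set \<Rightarrow> smc" where
  "sem_MC X = the_elem (sem ` X)"

end

theory Submission
  imports Defs "HOL-Library.Extended_Nonnegative_Real"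
begin

text \<open>
  A path of probability \<open>p\<close> and reward \<open>r\<close> is given the weight \<open>p + p r \<epsilon>\<close>, a dual number
  (\<open>\<epsilon>\<^sup>2 = 0\<close>) with coefficients in \<open>[0, \<infinity>]\<close>. Weights are multiplicative along paths, so
  \<open>RPr + ERw \<epsilon>\<close> is a path sum over a commutative semiring, composition of matrix pairs is the matrix
  product over it, and the block matrices in the trace encode it. The path sums towards a fixed exit
  form the least solution of a linear system with one unknown per position and per exit. All
  preservation properties then compare least solutions, where each inequality only requires a
  presolution. For the trace, adding the equations \<open>X k = X (E k)\<close> for the exits \<open>k\<close> in \<open>[l]\<close> gives a
  system which reduces to that of the traced chain when these exits are eliminated, and to the series
  \<open>A (1 + B + B\<^sup>2 + \<dots>) C\<close> when the positions are eliminated.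
\<close>

section \<open>Dual numbers\<close>

text \<open>The equations alone do not determine the path sums: in the probability coefficient,
  every constant solves them on a closed class of positions with row sums 1, and likewise on a cycle
  of fed-back exits. Least solutions give such parts the value 0, which is what their empty sets of
  paths demand. Reward enters as p r because this product adds up over paths and obeys the Leibniz
  rule under concatenation, which is multiplication of dual numbers. With coefficients in
  [0, \<infinity>] every supremum exists, so sums can be exchanged and systems compared before any
  convergence is known. The price is paid on the way back to the reals: \<open>infsum\<close> and
  \<open>suminf\<close> are meaningful only for convergent families, so finiteness has to be proved.
  Probabilities are bounded by 1 at once. Rewards are the hard point: a chain may collect positive
  reward forever, and such runs must not count, so rewards have to be weighed with the probability
  of still reaching the exit. Convergence of the trace series is then read off from the traced
  chain, whose path sums are already known to be finite.\<close>

datatype dnum = Dn (base: ennreal) (eps: ennreal)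

instantiation dnum :: comm_semiring_1
begin

definition zero_dnum :: dnum where "0 = Dn 0 0"
definition one_dnum :: dnum where "1 = Dn 1 0"
definition plus_dnum :: "dnum \<Rightarrow> dnum \<Rightarrow> dnum" where
  "x + y = Dn (base x + base y) (eps x + eps y)"
definition times_dnum :: "dnum \<Rightarrow> dnum \<Rightarrow> dnum" where
  "x * y = Dn (base x * base y) (base x * eps y + eps x * base y)"

instance
  by standard
    (auto simp: zero_dnum_def one_dnum_def plus_dnum_def times_dnum_def algebra_simps)

end

instantiation dnum :: order
begin

definition less_eq_dnum :: "dnum \<Rightarrow> dnum \<Rightarrow> bool" where
  "x \<le> y \<longleftrightarrow> base x \<le> base y \<and> eps x \<le> eps y"
definition less_dnum :: "dnum \<Rightarrow> dnum \<Rightarrow> bool" where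
  "x < y \<longleftrightarrow> x \<le> y \<and> \<not> y \<le> (x::dnum)"

instance
  by standard (auto simp: less_eq_dnum_def less_dnum_def intro: dnum.expand)

end

lemma base_simps [simp]:
  "base 0 = 0" "base 1 = 1" "base (x + y) = base x + base y" "base (x * y) = base x * base y"
  by (simp_all add: zero_dnum_def one_dnum_def plus_dnum_def times_dnum_def)

lemma eps_simps [simp]:
  "eps 0 = 0" "eps 1 = 0" "eps (x + y) = eps x + eps y"
  "eps (x * y) = base x * eps y + eps x * base y"
  by (simp_all add: zero_dnum_def one_dnum_def plus_dnum_def times_dnum_def)

instance dnum :: ordered_comm_semiring
  by standard (auto simp: less_eq_dnum_def intro!: add_mono mult_left_mono mult_right_mono)

lemma dnum_nonneg [simp]: "0 \<le> (x::dnum)"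
  by (simp add: less_eq_dnum_def)

lemma base_sum [simp]: "base (\<Sum>x\<in>A. f x) = (\<Sum>x\<in>A. base (f x))"
  by (induction A rule: infinite_finite_induct) auto

lemma eps_sum [simp]: "eps (\<Sum>x\<in>A. f x) = (\<Sum>x\<in>A. eps (f x))"
  by (induction A rule: infinite_finite_induct) auto

text \<open>The coefficientwise supremum; for increasing sequences it acts as a limit and commutes
  with finite sums and with multiplication.\<close>

definition dsup :: "(nat \<Rightarrow> dnum) \<Rightarrow> dnum" where
  "dsup f = Dn (SUP n. base (f n)) (SUP n. eps (f n))"

lemma incseq_base: "incseq f \<Longrightarrow> incseq (\<lambda>n. base (f n))"
  and incseq_eps: "incseq f \<Longrightarrow> incseq (\<lambda>n. eps (f n))"
  by (auto simp: incseq_def less_eq_dnum_def)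

lemma dsup_upper: "f n \<le> dsup f"
  by (auto simp: dsup_def less_eq_dnum_def intro: SUP_upper)

lemma dsup_least: "(\<And>n. f n \<le> y) \<Longrightarrow> dsup f \<le> y"
  by (auto simp: dsup_def less_eq_dnum_def intro: SUP_least)

lemma dsup_add:
  "incseq f \<Longrightarrow> incseq g \<Longrightarrow> dsup (\<lambda>n. f n + g n) = dsup f + dsup g"
  by (simp add: dsup_def plus_dnum_def ennreal_SUP_add incseq_base incseq_eps)

text \<open>The \<epsilon>-coefficient of a product is a sum of two sequences. The supremum splits
  over this sum because both are increasing.\<close>

lemma dsup_cmult: "incseq f \<Longrightarrow> dsup (\<lambda>n. a * f n) = a * dsup f"
proof -
  assume f: "incseq f"
  have "incseq (\<lambda>n. base a * eps (f n))" "incseq (\<lambda>n. eps a * base (f n))"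
    using incseq_base[OF f] incseq_eps[OF f] by (auto simp: incseq_def intro!: mult_left_mono)
  then show ?thesis
    by (simp add: dsup_def times_dnum_def ennreal_SUP_add SUP_mult_left_ennreal)
qed

lemma dsup_const [simp]: "dsup (\<lambda>n. a) = a"
  by (simp add: dsup_def)

lemma incseq_dnum_sum:
  fixes f :: "'a \<Rightarrow> nat \<Rightarrow> dnum"
  shows "(\<And>x. x \<in> A \<Longrightarrow> incseq (f x)) \<Longrightarrow> incseq (\<lambda>n. \<Sum>x\<in>A. f x n)"
  by (auto simp: incseq_def intro!: sum_mono)

lemma incseq_dnum_cmult: "incseq f \<Longrightarrow> incseq (\<lambda>n. a * f n :: dnum)"
  by (auto simp: incseq_def intro!: mult_left_mono)

lemma dsup_sum:
  "(\<And>x. x \<in> A \<Longrightarrow> incseq (f x)) \<Longrightarrow> dsup (\<lambda>n. \<Sum>x\<in>A. f x n) = (\<Sum>x\<in>A. dsup (f x))"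
  by (induction A rule: infinite_finite_induct) (auto simp: dsup_add incseq_dnum_sum)

lemma dsup_Suc: "incseq f \<Longrightarrow> dsup (\<lambda>n. f (Suc n)) = dsup f"
  by (intro antisym dsup_least dsup_upper order_trans[OF incseq_SucD dsup_upper])

text \<open>\<open>ennreal\<close> sends negative reals to 0, so this embedding is injective and
  compatible with + and * only on nonnegative arguments; hence the side conditions below.\<close>

definition dn :: "real \<Rightarrow> real \<Rightarrow> dnum" where
  "dn p r = Dn (ennreal p) (ennreal r)"

lemma base_dn [simp]: "base (dn p r) = ennreal p"
  and eps_dn [simp]: "eps (dn p r) = ennreal r"
  by (simp_all add: dn_def)

lemma dn_0 [simp]: "dn 0 0 = 0" and dn_1 [simp]: "dn 1 0 = 1"
  by (simp_all add: dn_def zero_dnum_def one_dnum_def)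

lemma dn_eq_iff:
  "p \<ge> 0 \<Longrightarrow> r \<ge> 0 \<Longrightarrow> p' \<ge> 0 \<Longrightarrow> r' \<ge> 0 \<Longrightarrow> dn p r = dn p' r' \<longleftrightarrow> p = p' \<and> r = r'"
  by (simp add: dn_def)

lemma dn_add:
  "p \<ge> 0 \<Longrightarrow> r \<ge> 0 \<Longrightarrow> p' \<ge> 0 \<Longrightarrow> r' \<ge> 0 \<Longrightarrow> dn p r + dn p' r' = dn (p + p') (r + r')"
  by (simp add: dn_def plus_dnum_def ennreal_plus)

lemma dn_mult:
  "p \<ge> 0 \<Longrightarrow> r \<ge> 0 \<Longrightarrow> p' \<ge> 0 \<Longrightarrow> r' \<ge> 0 \<Longrightarrow> dn p r * dn p' r' = dn (p * p') (p * r' + r * p')"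
  by (simp add: dn_def times_dnum_def ennreal_plus ennreal_mult)

lemma dn_sum:
  "(\<And>x. x \<in> A \<Longrightarrow> p x \<ge> 0) \<Longrightarrow> (\<And>x. x \<in> A \<Longrightarrow> r x \<ge> 0) \<Longrightarrow>
   (\<Sum>x\<in>A. dn (p x) (r x)) = dn (\<Sum>x\<in>A. p x) (\<Sum>x\<in>A. r x)"
  by (intro dnum.expand) auto

section \<open>Least solutions of linear systems\<close>

text \<open>Kleene iteration of X = c + A X from 0. The value 0 outside \<open>S\<close> lets the
  minimality statement \<open>sol_least\<close> hold at every argument.\<close>

fun iter :: "'s set \<Rightarrow> ('s \<Rightarrow> 's \<Rightarrow> dnum) \<Rightarrow> ('s \<Rightarrow> dnum) \<Rightarrow> nat \<Rightarrow> 's \<Rightarrow> dnum" where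
  "iter S A c 0 s = 0"
| "iter S A c (Suc n) s = (if s \<in> S then c s + (\<Sum>t\<in>S. A s t * iter S A c n t) else 0)"

definition sol :: "'s set \<Rightarrow> ('s \<Rightarrow> 's \<Rightarrow> dnum) \<Rightarrow> ('s \<Rightarrow> dnum) \<Rightarrow> 's \<Rightarrow> dnum" where
  "sol S A c s = dsup (\<lambda>n. iter S A c n s)"

lemma iter_le_Suc: "iter S A c n s \<le> iter S A c (Suc n) s"
proof (induction n arbitrary: s)
  case (Suc n)
  show ?case
    unfolding iter.simps(2)[of S A c n s] iter.simps(2)[of S A c "Suc n" s]
    by (auto intro!: add_left_mono sum_mono mult_left_mono Suc.IH simp del: iter.simps)
qed auto

lemma incseq_iter: "incseq (\<lambda>n. iter S A c n s)"
  using iter_le_Suc by (intro incseq_SucI)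

text \<open>The affine map X \<mapsto> c + A X involves only finite sums and products, so it
  commutes with the supremum of the increasing iterates.\<close>

lemma sol_unfold:
  assumes "s \<in> S"
  shows "sol S A c s = c s + (\<Sum>t\<in>S. A s t * sol S A c t)"
proof -
  have inc: "incseq (\<lambda>n. A s t * iter S A c n t)" for t
    by (intro incseq_dnum_cmult incseq_iter)
  have "sol S A c s = dsup (\<lambda>n. c s + (\<Sum>t\<in>S. A s t * iter S A c n t))"
    unfolding sol_def using assms by (subst dsup_Suc[OF incseq_iter, symmetric]) simp
  also have "\<dots> = c s + (\<Sum>t\<in>S. A s t * sol S A c t)"
    by (subst dsup_add)
      (auto simp: sol_def dsup_sum inc dsup_cmult incseq_iter intro!: incseq_dnum_sum)
  finally show ?thesis .
qed

lemma sol_outside: "s \<notin> S \<Longrightarrow> sol S A c s = 0"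
proof -
  assume "s \<notin> S"
  then have "iter S A c n s = 0" for n by (cases n) auto
  then show ?thesis by (simp add: sol_def)
qed

lemma sol_least:
  assumes "\<And>s. s \<in> S \<Longrightarrow> c s + (\<Sum>t\<in>S. A s t * Y t) \<le> Y s"
  shows "sol S A c s \<le> Y s"
proof -
  have "iter S A c n s \<le> Y s" for n
  proof (induction n arbitrary: s)
    case (Suc n)
    then have "c s + (\<Sum>t\<in>S. A s t * iter S A c n t) \<le> c s + (\<Sum>t\<in>S. A s t * Y t)"
      by (intro add_left_mono sum_mono mult_left_mono) auto
    then show ?case using assms by (auto intro: order_trans)
  qed auto
  then show ?thesis unfolding sol_def by (rule dsup_least)
qed

lemma sol_cong:
  assumes "\<And>s. s \<in> S \<Longrightarrow> c s = c' s" "\<And>s t. s \<in> S \<Longrightarrow> t \<in> S \<Longrightarrow> A s t = A' s t"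
  shows "sol S A c s = sol S A' c' s"
proof -
  have "iter S A c n s = iter S A' c' n s" for n
    by (induction n arbitrary: s) (auto simp: assms)
  then show ?thesis by (simp add: sol_def)
qed

text \<open>Every iterate is linear in the constant term, and the supremum preserves this. It allows
  boundary values to be split exit by exit.\<close>

lemma sol_linear:
  "sol S A (\<lambda>s. \<Sum>k\<in>K. b k * c k s) s = (\<Sum>k\<in>K. b k * sol S A (c k) s)"
proof -
  have "iter S A (\<lambda>s. \<Sum>k\<in>K. b k * c k s) n s = (\<Sum>k\<in>K. b k * iter S A (c k) n s)" for n
  proof (induction n arbitrary: s)
    case (Suc n)
    have "(\<Sum>t\<in>S. A s t * (\<Sum>k\<in>K. b k * iter S A (c k) n t))
        = (\<Sum>k\<in>K. b k * (\<Sum>t\<in>S. A s t * iter S A (c k) n t))"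
      unfolding sum_distrib_left by (subst sum.swap) (simp add: mult_ac)
    then show ?case by (simp add: Suc distrib_left sum.distrib)
  qed auto
  then show ?thesis
    by (simp add: sol_def dsup_sum dsup_cmult incseq_iter incseq_dnum_cmult)
qed

text \<open>The third assumption, being required for all \<open>X\<close>, says that row
  \<open>f s\<close> of \<open>A'\<close> is the push-forward of row \<open>s\<close> of
  \<open>A\<close> along \<open>f\<close>: the image of \<open>f\<close> is closed under transitions
  and behaves like \<open>S\<close>. This covers isomorphisms, both summands of a sum, and the
  second factor of a composite.\<close>

lemma sol_embed:
  assumes "\<And>s. s \<in> S \<Longrightarrow> f s \<in> S'" "\<And>s. s \<in> S \<Longrightarrow> c' (f s) = c s"
    and "\<And>s X. s \<in> S \<Longrightarrow> (\<Sum>t\<in>S'. A' (f s) t * X t) = (\<Sum>t\<in>S. A s t * X (f t))"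
    and "s \<in> S"
  shows "sol S' A' c' (f s) = sol S A c s"
proof -
  have "iter S' A' c' n (f s) = iter S A c n s" for n
    using \<open>s \<in> S\<close> by (induction n arbitrary: s) (auto simp: assms(1,2,3))
  then show ?thesis by (simp add: sol_def)
qed

text \<open>The vector \<open>A^d c\<close>. The iterates are the partial sums of the Neumann series
  of these vectors, which ties least solutions to the series defining the trace.\<close>

fun orbit :: "'s set \<Rightarrow> ('s \<Rightarrow> 's \<Rightarrow> dnum) \<Rightarrow> ('s \<Rightarrow> dnum) \<Rightarrow> nat \<Rightarrow> 's \<Rightarrow> dnum" where
  "orbit S A c 0 s = c s"
| "orbit S A c (Suc n) s = (\<Sum>t\<in>S. A s t * orbit S A c n t)"

lemma iter_eq_sum_orbit: "s \<in> S \<Longrightarrow> iter S A c n s = (\<Sum>d<n. orbit S A c d s)"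
proof (induction n arbitrary: s)
  case (Suc n)
  have "(\<Sum>t\<in>S. A s t * iter S A c n t) = (\<Sum>t\<in>S. \<Sum>d<n. A s t * orbit S A c d t)"
    by (simp add: Suc.IH sum_distrib_left)
  also have "\<dots> = (\<Sum>d<n. orbit S A c (Suc d) s)"
    by (subst sum.swap) simp
  finally show ?case
    using Suc.prems by (simp add: sum.lessThan_Suc_shift del: sum.lessThan_Suc)
qed auto

section \<open>Chains as linear systems\<close>

text \<open>Substochastic rows suffice to bound path sums, and they are inherited by isomorphic
  copies, sums, composites and traces.\<close>

definition submc :: "'q omc \<Rightarrow> bool" where
  "submc C \<longleftrightarrow>
     finite (pos C) \<and> (\<forall>i<ins C. entr C i \<in> targets C) \<and>
     (\<forall>q\<in>pos C. \<forall>s\<in>targets C. prob C q s \<ge> 0) \<and>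
     (\<forall>q\<in>pos C. (\<Sum>s\<in>targets C. prob C q s) \<le> 1) \<and>
     (\<forall>q\<in>pos C. rwd C q \<ge> 0)"

lemma submcD:
  assumes "submc C"
  shows "finite (pos C)" "\<And>i. i < ins C \<Longrightarrow> entr C i \<in> targets C"
    "\<And>q s. q \<in> pos C \<Longrightarrow> s \<in> targets C \<Longrightarrow> prob C q s \<ge> 0"
    "\<And>q. q \<in> pos C \<Longrightarrow> (\<Sum>s\<in>targets C. prob C q s) \<le> 1"
    "\<And>q. q \<in> pos C \<Longrightarrow> rwd C q \<ge> 0"
    "finite (targets C)"
  using assms by (auto simp: submc_def targets_def)

lemma romc_submc: "romc m n C \<Longrightarrow> submc C"
  unfolding romc_def submc_def by fastforce

lemma Inl_targets [simp]: "Inl q \<in> targets C \<longleftrightarrow> q \<in> pos C"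
  and Inr_targets [simp]: "Inr k \<in> targets C \<longleftrightarrow> k < outs C"
  by (auto simp: targets_def)

lemma sum_targets:
  fixes f :: "'q + nat \<Rightarrow> 'a::comm_monoid_add"
  assumes "finite (pos C)"
  shows "(\<Sum>s\<in>targets C. f s) = (\<Sum>q\<in>pos C. f (Inl q)) + (\<Sum>k<outs C. f (Inr k))"
  using assms by (simp add: targets_def sum.Plus)

text \<open>The reward of the position being left is charged to the step, so the product along s1,
  ..., sk, j collects the rewards of exactly these k positions. Exits have no successors; their
  values come from \<open>bnd\<close> alone.\<close>

definition wt :: "'q omc \<Rightarrow> 'q + nat \<Rightarrow> 'q + nat \<Rightarrow> dnum" where
  "wt C u s = (case u of Inl q \<Rightarrow> dn (prob C q s) (prob C q s * rwd C q) | Inr k \<Rightarrow> 0)"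

definition bnd :: "(nat \<Rightarrow> dnum) \<Rightarrow> 'q + nat \<Rightarrow> dnum" where
  "bnd b u = (case u of Inl q \<Rightarrow> 0 | Inr k \<Rightarrow> b k)"

lemma wt_simps [simp]:
  "wt C (Inl q) s = dn (prob C q s) (prob C q s * rwd C q)" "wt C (Inr k) s = 0"
  by (simp_all add: wt_def)

lemma bnd_simps [simp]: "bnd b (Inl q) = 0" "bnd b (Inr k) = b k"
  by (simp_all add: bnd_def)

text \<open>Arbitrary values at the exits stand for whatever happens after leaving the chain: a
  second chain in a composite, or re-entry through the feedback.\<close>

definition val :: "'q omc \<Rightarrow> (nat \<Rightarrow> dnum) \<Rightarrow> 'q + nat \<Rightarrow> dnum" where
  "val C b = sol (targets C) (wt C) (bnd b)"

definition reach :: "'q omc \<Rightarrow> nat \<Rightarrow> 'q + nat \<Rightarrow> dnum" where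
  "reach C j = val C (\<lambda>k. of_bool (k = j))"

lemma val_Inr [simp]: "k < outs C \<Longrightarrow> val C b (Inr k) = b k"
  by (simp add: val_def sol_unfold)

lemma val_Inl: "q \<in> pos C \<Longrightarrow> val C b (Inl q) = (\<Sum>s\<in>targets C. wt C (Inl q) s * val C b s)"
  unfolding val_def by (subst sol_unfold) auto

lemma val_least:
  assumes "\<And>k. k < outs C \<Longrightarrow> b k \<le> Y (Inr k)"
    and "\<And>q. q \<in> pos C \<Longrightarrow> (\<Sum>s\<in>targets C. wt C (Inl q) s * Y s) \<le> Y (Inl q)"
  shows "val C b s \<le> Y s"
  unfolding val_def
proof (rule sol_least)
  fix s assume "s \<in> targets C"
  then show "bnd b s + (\<Sum>t\<in>targets C. wt C s t * Y t) \<le> Y s"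
    using assms by (cases s) (auto simp del: wt_simps(1))
qed

lemma reach_Inr [simp]: "k < outs C \<Longrightarrow> reach C j (Inr k) = of_bool (k = j)"
  by (simp add: reach_def)

lemma reach_Inl: "q \<in> pos C \<Longrightarrow> reach C j (Inl q) = (\<Sum>s\<in>targets C. wt C (Inl q) s * reach C j s)"
  unfolding reach_def by (rule val_Inl)

lemma val_eq_sum_reach: "val C b s = (\<Sum>k<outs C. b k * reach C k s)"
proof -
  have "val C b s = sol (targets C) (wt C) (\<lambda>s. \<Sum>k<outs C. b k * bnd (\<lambda>k'. of_bool (k' = k)) s) s"
    unfolding val_def
  proof (rule sol_cong)
    fix s assume "s \<in> targets C"
    then show "bnd b s = (\<Sum>k<outs C. b k * bnd (\<lambda>k'. of_bool (k' = k)) s)"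
      by (cases s) (auto simp: of_bool_def if_distrib cong: if_cong)
  qed simp
  then show ?thesis by (simp add: sol_linear reach_def val_def)
qed

section \<open>Bounds on reachability probability and expected reward\<close>

lemma sum_base_reach_le_1:
  assumes "submc C"
  shows "(\<Sum>k<outs C. base (reach C k s)) \<le> 1"
proof -
  note C = submcD[OF assms]
  \<comment> \<open>The coefficient \<infinity> makes the reward part of the presolution inequality
    trivial, leaving only the bound on the row sums.\<close>
  have "val C (\<lambda>_. 1) s \<le> Dn 1 \<infinity>"
  proof (rule val_least[where Y = "\<lambda>_. Dn 1 \<infinity>"])
    fix q assume q: "q \<in> pos C"
    have "(\<Sum>s\<in>targets C. ennreal (prob C q s)) = ennreal (\<Sum>s\<in>targets C. prob C q s)"
      using C(3)[OF q] by simp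
    also have "\<dots> \<le> 1" using C(4)[OF q] by simp
    finally show "(\<Sum>s\<in>targets C. wt C (Inl q) s * Dn 1 \<infinity>) \<le> Dn 1 \<infinity>"
      by (simp add: less_eq_dnum_def)
  qed (simp add: less_eq_dnum_def)
  then show ?thesis
    by (simp add: val_eq_sum_reach less_eq_dnum_def)
qed

lemma base_reach_le_1:
  assumes "submc C" "j < outs C"
  shows "base (reach C j s) \<le> 1"
proof -
  have "base (reach C j s) \<le> (\<Sum>k<outs C. base (reach C k s))"
    using assms(2) by (intro sum_nonneg_leq_bound[OF _ _ refl]) auto
  then show ?thesis using sum_base_reach_le_1[OF assms(1)] order_trans by blast
qed

text \<open>
  Let \<open>T\<close> be the transition operator, \<open>H\<close> the reachability probability of exit \<open>j\<close> and \<open>H\<^sub>N\<close> its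
  part from paths with fewer than \<open>N\<close> positions, so that \<open>H = T\<^sup>N H + H\<^sub>N\<close>. For large \<open>N\<close> the
  supports of \<open>H\<close> and \<open>H\<^sub>N\<close> agree, hence \<open>R H \<le> K H\<^sub>N\<close> for some finite \<open>K\<close>. Then
  \<open>V = K (H + T H + \<dots> + T\<^bsup>N-1\<^esup> H)\<close> is bounded by \<open>K N\<close> and satisfies \<open>R H + T V \<le> V\<close>, so it bounds
  the expected reward.
\<close>

lemma eps_reach_finite:
  assumes C: "submc C" and j: "j < outs C"
  shows "eps (reach C j s) < \<infinity>"
proof -
  note CD = submcD[OF C]
  define S where "S = targets C"
  define h where "h n s = base (iter S (wt C) (bnd (\<lambda>k. of_bool (k = j))) n s)" for n s
  define H where "H s = base (reach C j s)" for s
  define p where "p q s = ennreal (prob C q s)" for q s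
  have finS: "finite S" using CD by (simp add: S_def)
  have H_SUP: "H s = (SUP n. h n s)" for s
    by (simp add: H_def h_def reach_def val_def sol_def dsup_def S_def)
  have h_mono: "h n s \<le> h n' s" if "n \<le> n'" for n n' s
    using incseq_base[OF incseq_iter, of S "wt C" "bnd (\<lambda>k. of_bool (k = j))" s] that
    by (simp add: h_def incseq_def)
  have H_le_1: "H s \<le> 1" for s
    unfolding H_def by (rule base_reach_le_1[OF C j])
  have H_Inl: "H (Inl q) = (\<Sum>s\<in>S. p q s * H s)" if "q \<in> pos C" for q
    using reach_Inl[OF that, of j] by (simp add: H_def p_def S_def)
  have h_Inl: "h (Suc n) (Inl q) = (\<Sum>s\<in>S. p q s * h n s)" if "q \<in> pos C" for n q
    using that by (simp add: h_def p_def S_def)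
  define tl where "tl = rec_nat H (\<lambda>_ f u. case u of Inl q \<Rightarrow> \<Sum>s\<in>S. p q s * f s | Inr k \<Rightarrow> 0)"
  have tl_0: "tl 0 = H"
    and tl_Inl: "tl (Suc d) (Inl q) = (\<Sum>s\<in>S. p q s * tl d s)"
    and tl_Inr: "tl (Suc d) (Inr k) = 0" for d q k
    by (simp_all add: tl_def)
  have split: "tl N s + h N s = H s" if "s \<in> S" for N s
    using that
  proof (induction N arbitrary: s)
    case 0
    then show ?case by (simp add: tl_0 h_def)
  next
    case (Suc N)
    show ?case
    proof (cases s)
      case (Inl q)
      then have q: "q \<in> pos C" using Suc.prems by (simp add: S_def)
      have "tl (Suc N) s + h (Suc N) s = (\<Sum>s\<in>S. p q s * (tl N s + h N s))"
        by (simp add: Inl h_Inl[OF q] tl_Inl distrib_left sum.distrib)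
      also have "\<dots> = H s" by (simp add: Suc.IH H_Inl[OF q] Inl)
      finally show ?thesis .
    next
      case (Inr k)
      then show ?thesis using Suc.prems by (simp add: tl_Inr h_def H_def S_def)
    qed
  qed
  have tl_le_1: "tl d s \<le> 1" if "s \<in> S" for d s
    using split[OF that, of d] H_le_1[of s] by (metis le_iff_add order_trans)
  \<comment> \<open>Cancellation in [0, \<infinity>] needs a finite term: \<open>tl N s\<close> is
    added on both sides and removed again because it is at most 1.\<close>
  have telescope: "(\<Sum>d<N. tl (Suc d) s) + h N s = (\<Sum>d<N. tl d s)" if "s \<in> S" for N s
  proof -
    have "tl N s + ((\<Sum>d<N. tl (Suc d) s) + h N s) = (\<Sum>d<N. tl (Suc d) s) + H s"
      using split[OF that, of N] by (simp add: ac_simps)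
    also have "\<dots> = (\<Sum>d<Suc N. tl d s)"
      unfolding sum.lessThan_Suc_shift by (simp add: tl_0 add.commute)
    also have "\<dots> = tl N s + (\<Sum>d<N. tl d s)" by (simp add: add.commute)
    finally show ?thesis
      using tl_le_1[OF that, of N] by (auto simp: ennreal_add_left_cancel top_unique)
  qed
  have "\<exists>N. \<forall>s\<in>S. H s > 0 \<longrightarrow> h N s > 0"
  proof -
    have "\<exists>n. H s > 0 \<longrightarrow> h n s > 0" for s
      by (auto simp: H_SUP less_SUP_iff)
    then obtain n where n: "\<And>s. H s > 0 \<Longrightarrow> h (n s) s > 0" by metis
    \<comment> \<open>The sum of the indices \<open>n s\<close> over the finite set \<open>S\<close>
      dominates each of them, so one index serves all targets.\<close>
    have "h (\<Sum>s\<in>S. n s) s > 0" if "s \<in> S" "H s > 0" for s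
      using n[OF that(2)] h_mono[of "n s" "\<Sum>s\<in>S. n s" s] that(1) finS
      by (meson order_less_le_trans member_le_sum zero_le)
    then show ?thesis by blast
  qed
  then obtain N where N: "\<And>s. s \<in> S \<Longrightarrow> H s > 0 \<Longrightarrow> h N s > 0" by blast
  define Q where "Q = {q \<in> pos C. H (Inl q) > 0}"
  \<comment> \<open>A sum of ratios bounds each single ratio. It ranges over the positions that can
    reach exit \<open>j\<close>, where \<open>h N\<close> does not vanish, so it is finite; at all
    other positions \<open>H\<close> is 0.\<close>
  define K where "K = (\<Sum>q\<in>Q. ennreal (rwd C q) / h N (Inl q))"
  have "h N (Inl q) \<noteq> 0" if "q \<in> Q" for q
    using N[of "Inl q"] that by (simp add: Q_def S_def)
  then have K_fin: "K < \<infinity>"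
    using CD(1) unfolding K_def
    by (auto simp: Q_def ennreal_divide_eq_top_iff top.not_eq_extremum[symmetric])
  have RH: "ennreal (rwd C q) * H (Inl q) \<le> K * h N (Inl q)" if q: "q \<in> pos C" for q
  proof (cases "H (Inl q) > 0")
    case True
    then have hN: "h N (Inl q) > 0" using N q by (simp add: S_def)
    have "h N (Inl q) \<le> 1"
      using split[of "Inl q" N] H_le_1[of "Inl q"] q
      by (metis Inl_targets S_def add.commute le_iff_add order_trans)
    then have fin: "h N (Inl q) < \<infinity>" using order_le_less_trans by fastforce
    have "ennreal (rwd C q) * H (Inl q) \<le> ennreal (rwd C q)"
      using mult_left_mono[OF H_le_1] by fastforce
    also have "\<dots> = ennreal (rwd C q) / h N (Inl q) * h N (Inl q)"
      using hN fin by (simp add: ennreal_divide_times divide_mult_eq)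
    also have "\<dots> \<le> K * h N (Inl q)"
      unfolding K_def using True q CD(1)
      by (intro mult_right_mono member_le_sum) (auto simp: Q_def)
    finally show ?thesis .
  qed auto
  define V where "V s = K * (\<Sum>d<N. tl d s)" for s
  have "reach C j s \<le> Dn (H s) (V s)"
    unfolding reach_def
  proof (rule val_least)
    fix k assume "k < outs C"
    then show "of_bool (k = j) \<le> Dn (H (Inr k)) (V (Inr k))"
      by (simp add: H_def less_eq_dnum_def)
  next
    fix q assume q: "q \<in> pos C"
    have pr: "ennreal (prob C q s * rwd C q) = ennreal (rwd C q) * p q s" if "s \<in> S" for s
      using CD(3)[OF q] CD(5)[OF q] that by (simp add: p_def S_def ennreal_mult mult.commute)
    have "(\<Sum>s\<in>S. p q s * V s + ennreal (prob C q s * rwd C q) * H s)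
        = (\<Sum>s\<in>S. p q s * V s) + ennreal (rwd C q) * H (Inl q)"
      by (simp add: sum.distrib pr H_Inl[OF q] sum_distrib_left mult.assoc)
    also have "(\<Sum>s\<in>S. p q s * V s) = K * (\<Sum>d<N. tl (Suc d) (Inl q))"
      unfolding V_def tl_Inl sum_distrib_left by (subst sum.swap) (simp add: mult_ac)
    also have "\<dots> + ennreal (rwd C q) * H (Inl q) \<le>
        K * (\<Sum>d<N. tl (Suc d) (Inl q)) + K * h N (Inl q)"
      by (intro add_left_mono RH q)
    also have "\<dots> = V (Inl q)"
      using telescope[of "Inl q" N] q by (simp add: V_def S_def distrib_left[symmetric])
    finally show "(\<Sum>s\<in>targets C. wt C (Inl q) s * Dn (H s) (V s)) \<le> Dn (H (Inl q)) (V (Inl q))"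
      by (simp add: less_eq_dnum_def H_Inl[OF q] S_def p_def)
  qed
  moreover have "V s < \<infinity>" if "s \<in> S"
  proof -
    have "(\<Sum>d<N. tl d s) \<le> (\<Sum>d<N. 1)" by (intro sum_mono tl_le_1 that)
    also have "\<dots> < \<infinity>" by (simp add: of_nat_less_top)
    finally show ?thesis using K_fin by (simp add: V_def ennreal_mult_less_top)
  qed
  ultimately show ?thesis
    using sol_outside[of s S]
    by (cases "s \<in> S")
      (auto simp: less_eq_dnum_def reach_def val_def S_def intro: order_le_less_trans)
qed

text \<open>Every finite subset of \<open>A\<close> lies in some \<open>L n\<close>, so for
  nonnegative terms the sums over the \<open>L n\<close> are cofinal among all finite partial sums.
  Finiteness of their supremum is what yields summability over the reals.\<close>

lemma infsum_eq_SUP_exhaustion: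
  fixes f :: "'a \<Rightarrow> real"
  assumes f: "\<And>x. x \<in> A \<Longrightarrow> f x \<ge> 0" and L: "incseq L" "\<And>n. finite (L n)" "A = (\<Union>n. L n)"
    and fin: "(SUP n. ennreal (sum f (L n))) < \<infinity>"
  shows "f summable_on A" and "ennreal (infsum f A) = (SUP n. ennreal (sum f (L n)))"
proof -
  have cover: "\<exists>n. F \<subseteq> L n" if "finite F" "F \<subseteq> A" for F
    using that
  proof (induction F)
    case (insert x F)
    then obtain n n' where "F \<subseteq> L n" "x \<in> L n'" using L(3) by auto
    then show ?case
      using incseqD[OF L(1), of n "max n n'"] incseqD[OF L(1), of n' "max n n'"] by auto
  qed auto
  have bound: "\<exists>n. sum f F \<le> sum f (L n)" if F: "finite F" "F \<subseteq> A" for F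
  proof -
    obtain n where "F \<subseteq> L n" using cover[OF F] by blast
    then show ?thesis using f L by (intro exI[of _ n] sum_mono2) auto
  qed
  obtain r where r: "(SUP n. ennreal (sum f (L n))) = ennreal r" "r \<ge> 0"
    using fin by (metis infinity_ennreal_def less_top_ennreal)
  have "sum f F \<le> r" if F: "finite F" "F \<subseteq> A" for F
  proof -
    obtain n where "sum f F \<le> sum f (L n)" using bound[OF F] by blast
    moreover have "ennreal (sum f (L n)) \<le> ennreal r"
      unfolding r(1)[symmetric] by (rule SUP_upper) simp
    ultimately show ?thesis using r(2) by simp
  qed
  then show summable: "f summable_on A"
    using f by (intro nonneg_bdd_above_summable_on) (auto intro!: bdd_aboveI[of _ r])
  have "(SUP F\<in>{F. finite F \<and> F \<subseteq> A}. ennreal (sum f F)) = (SUP n. ennreal (sum f (L n)))"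
  proof (rule antisym)
    show "(SUP F\<in>{F. finite F \<and> F \<subseteq> A}. ennreal (sum f F)) \<le> (SUP n. ennreal (sum f (L n)))"
    proof (rule SUP_least)
      fix F assume "F \<in> {F. finite F \<and> F \<subseteq> A}"
      then obtain n where "sum f F \<le> sum f (L n)" using bound by blast
      then have "ennreal (sum f F) \<le> ennreal (sum f (L n))" by (rule ennreal_leI)
      also have "\<dots> \<le> (SUP n. ennreal (sum f (L n)))" by (rule SUP_upper) simp
      finally show "ennreal (sum f F) \<le> (SUP n. ennreal (sum f (L n)))" .
    qed
    show "(SUP n. ennreal (sum f (L n))) \<le> (SUP F\<in>{F. finite F \<and> F \<subseteq> A}. ennreal (sum f F))"
      using L by (intro SUP_mono) (auto intro!: bexI[of _ "L _"])
  qed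
  then show "ennreal (infsum f A) = (SUP n. ennreal (sum f (L n)))"
    using infsum_nonneg_is_SUPREMUM_ennreal[OF summable f] by simp
qed

section \<open>Path sums\<close>

lemma path_prob_Nil [simp]: "path_prob C j [] = 1"
  and path_rwd_Nil [simp]: "path_rwd C [] = 0"
  by (simp_all add: path_prob_def path_rwd_def)

lemma path_prob_Cons [simp]:
  "path_prob C j (q # ss) = prob C q (hd (path_tail ss j)) * path_prob C j ss"
  unfolding path_prob_def
  by (cases ss) (simp_all add: prod.lessThan_Suc_shift path_tail_def del: prod.lessThan_Suc)

lemma path_rwd_Cons [simp]: "path_rwd C (q # ss) = rwd C q + path_rwd C ss"
  unfolding path_rwd_def by (simp add: sum.lessThan_Suc_shift del: sum.lessThan_Suc)

lemma hd_path_tail_simps [simp]: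
  "hd (path_tail [] j) = Inr j" "hd (path_tail (q # ss) j) = Inl q"
  by (simp_all add: path_tail_def)

lemma hd_path_tail_in_targets:
  "set ss \<subseteq> pos C \<Longrightarrow> j < outs C \<Longrightarrow> hd (path_tail ss j) \<in> targets C"
  by (cases ss) auto

lemma path_prob_nonneg:
  assumes "submc C" "j < outs C" "set ss \<subseteq> pos C"
  shows "path_prob C j ss \<ge> 0"
  using assms(3)
  by (induction ss) (auto intro!: mult_nonneg_nonneg submcD(3)[OF assms(1)]
      hd_path_tail_in_targets assms(2))

lemma path_rwd_nonneg: "submc C \<Longrightarrow> set ss \<subseteq> pos C \<Longrightarrow> path_rwd C ss \<ge> 0"
  by (induction ss) (auto simp: submcD(5))

text \<open>Paths are sorted by their first element after the entrance, since this is the index of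
  the unknowns. The strict bound matches the iteration: a path with k positions first contributes to
  iterate k + 1, and iterate 0 is empty.\<close>

definition paths_upto :: "'q omc \<Rightarrow> nat \<Rightarrow> nat \<Rightarrow> 'q + nat \<Rightarrow> 'q list set" where
  "paths_upto C j n s = {ss. set ss \<subseteq> pos C \<and> hd (path_tail ss j) = s \<and> length ss < n}"

lemma finite_paths_upto: "finite (pos C) \<Longrightarrow> finite (paths_upto C j n s)"
  by (rule finite_subset[OF _ finite_lists_length_le[of "pos C" n]]) (auto simp: paths_upto_def)

lemma paths_upto_Suc_Inr: "paths_upto C j (Suc n) (Inr k) = (if k = j then {[]} else {})"
proof -
  have "ss = [] \<and> j = k" if "hd (path_tail ss j) = Inr k" for ss :: "'a list"
    using that by (cases ss) auto
  then show ?thesis by (auto simp: paths_upto_def)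
qed

lemma paths_upto_Suc_Inl:
  assumes "q \<in> pos C" "j < outs C"
  shows "paths_upto C j (Suc n) (Inl q) = (#) q ` (\<Union>s\<in>targets C. paths_upto C j n s)"
proof -
  have "ss \<in> (#) q ` (\<Union>s\<in>targets C. paths_upto C j n s)" if "ss \<in> paths_upto C j (Suc n) (Inl q)" for ss
    using that assms hd_path_tail_in_targets[OF _ assms(2)] by (cases ss) (auto simp: paths_upto_def)
  then show ?thesis using assms by (auto simp: paths_upto_def)
qed

lemma iter_eq_path_sum:
  assumes C: "submc C" and j: "j < outs C" and s: "s \<in> targets C"
  shows "iter (targets C) (wt C) (bnd (\<lambda>k. of_bool (k = j))) n s =
    (\<Sum>ss\<in>paths_upto C j n s. dn (path_prob C j ss) (path_prob C j ss * path_rwd C ss))"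
  using s
proof (induction n arbitrary: s)
  case 0
  then show ?case by (simp add: paths_upto_def)
next
  case (Suc n)
  let ?d = "\<lambda>ss. dn (path_prob C j ss) (path_prob C j ss * path_rwd C ss)"
  show ?case
  proof (cases s)
    case (Inr k)
    then show ?thesis using Suc.prems by (simp add: paths_upto_Suc_Inr)
  next
    case (Inl q)
    then have q: "q \<in> pos C" using Suc.prems by simp
    have step: "?d (q # ss) = wt C (Inl q) s * ?d ss"
      if "s \<in> targets C" "ss \<in> paths_upto C j n s" for s ss
    proof -
      have *: "prob C q s \<ge> 0" "rwd C q \<ge> 0" "path_prob C j ss \<ge> 0" "path_rwd C ss \<ge> 0"
        and hd: "hd (path_tail ss j) = s"
        using that q submcD(3,5)[OF C] path_prob_nonneg[OF C j] path_rwd_nonneg[OF C]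
        by (auto simp: paths_upto_def)
      show ?thesis
        unfolding wt_simps using * by (subst dn_mult) (simp_all add: hd algebra_simps)
    qed
    have "(\<Sum>ss\<in>paths_upto C j (Suc n) s. ?d ss) =
        (\<Sum>ss\<in>(\<Union>s\<in>targets C. paths_upto C j n s). ?d (q # ss))"
      unfolding Inl paths_upto_Suc_Inl[OF q j] by (subst sum.reindex) auto
    \<comment> \<open>The sets for different \<open>s\<close> are disjoint because \<open>s\<close>
      is the first element of the path.\<close>
    also have "\<dots> = (\<Sum>s\<in>targets C. \<Sum>ss\<in>paths_upto C j n s. ?d (q # ss))"
      using submcD(1,6)[OF C]
      by (intro sum.UNION_disjoint) (auto simp: finite_paths_upto, auto simp: paths_upto_def)
    also have "\<dots> = (\<Sum>s\<in>targets C. wt C (Inl q) s * (\<Sum>ss\<in>paths_upto C j n s. ?d ss))"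
      unfolding sum_distrib_left by (intro sum.cong refl step)
    finally show ?thesis
      using q by (simp add: Suc.IH Inl del: wt_simps)
  qed
qed

text \<open>The return to the reals. Paths of bounded length exhaust all paths, and finiteness of
  both coefficients of \<open>reach\<close> turns the suprema of their finite sums into genuine real
  sums.\<close>

lemma reach_eq_path_sum:
  assumes C: "submc C" and i: "i < ins C" and j: "j < outs C"
  shows path_prob_summable: "path_prob C j summable_on paths C i j"
    and path_rwd_summable: "(\<lambda>ss. path_prob C j ss * path_rwd C ss) summable_on paths C i j"
    and reach_eq_dn: "reach C j (entr C i) = dn (RPr C i j) (ERw C i j)"
    and RPr_nonneg: "RPr C i j \<ge> 0"
    and ERw_nonneg: "ERw C i j \<ge> 0"
    and RPr_zero_ERw: "RPr C i j = 0 \<Longrightarrow> ERw C i j = 0"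
proof -
  let ?L = "\<lambda>n. paths_upto C j n (entr C i)"
  have L: "incseq ?L" "\<And>n. finite (?L n)" "paths C i j = (\<Union>n. ?L n)"
    using submcD(1)[OF C] by (auto simp: incseq_def finite_paths_upto) (auto simp: paths_upto_def paths_def)
  have nn: "path_prob C j ss \<ge> 0" "path_prob C j ss * path_rwd C ss \<ge> 0" if "ss \<in> paths C i j" for ss
    using that path_prob_nonneg[OF C j] path_rwd_nonneg[OF C] by (auto simp: paths_def)
  have nnL: "path_prob C j ss \<ge> 0" "path_prob C j ss * path_rwd C ss \<ge> 0" if "ss \<in> ?L n" for ss n
    using nn[of ss] L(3) that by auto
  have reach: "reach C j (entr C i) = dsup (\<lambda>n. dn (sum (path_prob C j) (?L n))
      (\<Sum>ss\<in>?L n. path_prob C j ss * path_rwd C ss))"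
    using submcD(2)[OF C i] nnL
    by (simp add: reach_def val_def sol_def iter_eq_path_sum[OF C j] dn_sum)
  have b: "base (reach C j (entr C i)) = (SUP n. ennreal (sum (path_prob C j) (?L n)))"
    and e: "eps (reach C j (entr C i)) = (SUP n. ennreal (\<Sum>ss\<in>?L n. path_prob C j ss * path_rwd C ss))"
    by (simp_all add: reach dsup_def)
  have b_fin: "(SUP n. ennreal (sum (path_prob C j) (?L n))) < \<infinity>"
    using base_reach_le_1[OF C j, of "entr C i"] unfolding b by (rule order_le_less_trans) simp
  have e_fin: "(SUP n. ennreal (\<Sum>ss\<in>?L n. path_prob C j ss * path_rwd C ss)) < \<infinity>"
    using eps_reach_finite[OF C j, of "entr C i"] unfolding e .
  show sp: "path_prob C j summable_on paths C i j"
    by (rule infsum_eq_SUP_exhaustion(1)[OF nn(1) L b_fin])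
  show "(\<lambda>ss. path_prob C j ss * path_rwd C ss) summable_on paths C i j"
    by (rule infsum_eq_SUP_exhaustion(1)[OF nn(2) L e_fin])
  show "reach C j (entr C i) = dn (RPr C i j) (ERw C i j)"
    using infsum_eq_SUP_exhaustion(2)[OF nn(1) L b_fin] infsum_eq_SUP_exhaustion(2)[OF nn(2) L e_fin]
    by (intro dnum.expand) (simp add: b e RPr_def ERw_def)
  show "RPr C i j \<ge> 0" unfolding RPr_def by (intro infsum_nonneg nn)
  show "ERw C i j \<ge> 0" unfolding ERw_def by (intro infsum_nonneg nn)
  show "ERw C i j = 0" if "RPr C i j = 0"
  proof -
    \<comment> \<open>A nonnegative summable family with sum 0 vanishes termwise, so every summand
      of the expected reward vanishes as well.\<close>
    have "path_prob C j ss = 0" if "ss \<in> paths C i j" for ss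
      using nonneg_infsum_le_0D[OF _ sp nn(1) that] \<open>RPr C i j = 0\<close> by (simp add: RPr_def)
    then show ?thesis unfolding ERw_def by (intro infsum_0) simp
  qed
qed

lemma sem_in_smc_hom:
  assumes C: "submc C"
  shows "sem C \<in> smc_hom (ins C) (outs C)"
proof -
  have "(\<Sum>j<outs C. RPr C i j) \<le> 1" if "i < ins C" for i
  proof -
    have "ennreal (\<Sum>j<outs C. RPr C i j) = (\<Sum>j<outs C. base (reach C j (entr C i)))"
      using RPr_nonneg[OF C that]
      by (subst sum_ennreal[symmetric]) (auto simp: reach_eq_dn[OF C that])
    also have "\<dots> \<le> 1" by (rule sum_base_reach_le_1[OF C])
    finally show ?thesis by simp
  qed
  then show ?thesis
    using RPr_nonneg[OF C] ERw_nonneg[OF C] RPr_zero_ERw[OF C]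
    by (auto simp: smc_hom_def sem_def)
qed

lemma sem_eqI:
  assumes C: "submc C" and dims: "fst X \<in> carrier_mat (ins C) (outs C)" "snd X \<in> carrier_mat (ins C) (outs C)"
    and X: "\<And>i j. i < ins C \<Longrightarrow> j < outs C \<Longrightarrow> fst X $$ (i, j) \<ge> 0 \<and> snd X $$ (i, j) \<ge> 0 \<and>
      reach C j (entr C i) = dn (fst X $$ (i, j)) (snd X $$ (i, j))"
  shows "sem C = X"
proof -
  have "RPr C i j = fst X $$ (i, j) \<and> ERw C i j = snd X $$ (i, j)" if "i < ins C" "j < outs C" for i j
    using X[OF that] reach_eq_dn[OF C that] RPr_nonneg[OF C that] ERw_nonneg[OF C that]
    by (metis dn_eq_iff)
  then show ?thesis
    using dims by (auto simp: sem_def prod_eq_iff)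
qed

lemma sem_entry:
  assumes "submc C" "i < ins C" "j < outs C"
  shows "fst (sem C) $$ (i, j) \<ge> 0" "snd (sem C) $$ (i, j) \<ge> 0"
    "dn (fst (sem C) $$ (i, j)) (snd (sem C) $$ (i, j)) = reach C j (entr C i)"
  using assms RPr_nonneg[OF assms] ERw_nonneg[OF assms] reach_eq_dn[OF assms]
  by (simp_all add: sem_def)

lemma dim_sem [simp]:
  "dim_row (fst (sem C)) = ins C" "dim_col (fst (sem C)) = outs C"
  "dim_row (snd (sem C)) = ins C" "dim_col (snd (sem C)) = outs C"
  by (simp_all add: sem_def)

section \<open>Isomorphism classes\<close>

lemma bij_betw_targets:
  assumes "bij_betw f (pos C) (pos D)" "outs C = outs D"
  shows "bij_betw (map_sum f id) (targets C) (targets D)"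
proof (rule bij_betwI')
  fix s t assume "s \<in> targets C" "t \<in> targets C"
  then show "map_sum f id s = map_sum f id t \<longleftrightarrow> s = t"
    using bij_betw_imp_inj_on[OF assms(1)] by (cases s; cases t) (auto dest: inj_onD)
next
  fix s assume "s \<in> targets C"
  then show "map_sum f id s \<in> targets D"
    using assms by (cases s) (auto dest: bij_betwE)
next
  fix t assume t: "t \<in> targets D"
  show "\<exists>s\<in>targets C. t = map_sum f id s"
  proof (cases t)
    case (Inl q)
    then obtain q' where "q' \<in> pos C" "q = f q'"
      using t assms(1) by (auto simp: bij_betw_def)
    then show ?thesis using Inl by (intro bexI[of _ "Inl q'"]) auto
  next
    case (Inr k)
    then show ?thesis using t assms(2) by (intro bexI[of _ "Inr k"]) auto
  qed
qed

definition iso_via :: "('q \<Rightarrow> 'r) \<Rightarrow> 'q omc \<Rightarrow> 'r omc \<Rightarrow> bool" where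
  "iso_via f C D \<longleftrightarrow>
     ins D = ins C \<and> outs D = outs C \<and> bij_betw f (pos C) (pos D) \<and>
     (\<forall>i<ins C. entr D i = map_sum f id (entr C i)) \<and>
     (\<forall>q\<in>pos C. \<forall>s\<in>targets C. prob D (f q) (map_sum f id s) = prob C q s) \<and>
     (\<forall>q\<in>pos C. rwd D (f q) = rwd C q)"

lemma romc_iso_iff: "romc_iso C D \<longleftrightarrow> (\<exists>f. iso_via f C D)"
  unfolding romc_iso_def iso_via_def by (auto simp: eq_commute[of "ins D"] eq_commute[of "outs D"])

lemma iso_viaD:
  assumes "iso_via f C D"
  shows "ins D = ins C" "outs D = outs C" "bij_betw f (pos C) (pos D)"
    "bij_betw (map_sum f id) (targets C) (targets D)"
    "\<And>i. i < ins C \<Longrightarrow> entr D i = map_sum f id (entr C i)"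
    "\<And>q s. q \<in> pos C \<Longrightarrow> s \<in> targets C \<Longrightarrow> prob D (f q) (map_sum f id s) = prob C q s"
    "\<And>q. q \<in> pos C \<Longrightarrow> rwd D (f q) = rwd C q"
    "pos D = f ` pos C" "targets D = map_sum f id ` targets C"
  using assms bij_betw_targets[of f C D] by (simp_all add: iso_via_def bij_betw_def)

lemma submc_iso:
  assumes C: "submc C" and iso: "romc_iso C D"
  shows "submc D"
proof -
  note CD = submcD[OF C]
  obtain f where "iso_via f C D" using iso by (auto simp: romc_iso_iff)
  note f = iso_viaD[OF this]
  note pos = f(8) and tar = f(9)
  have "(\<Sum>s\<in>targets D. prob D (f q) s) = (\<Sum>s\<in>targets C. prob C q s)" if "q \<in> pos C" for q
    by (subst sum.reindex_bij_betw[OF f(4), symmetric]) (simp add: f(6) that)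
  then show ?thesis
    unfolding submc_def using CD f(1,5,6,7) by (auto simp: pos tar)
qed

lemma romc_of_iso:
  assumes C: "romc m n C" and iso: "romc_iso C D"
  shows "romc m n D"
proof -
  obtain f where "iso_via f C D" using iso by (auto simp: romc_iso_iff)
  note f = iso_viaD[OF this]
  have C': "ins C = m" "outs C = n" "disjoint_family_on (imm_exits C) ({..<m} <+> pos C)"
    "\<And>q. q \<in> pos C \<Longrightarrow> (\<Sum>s\<in>targets C. prob C q s) \<in> {0, 1}"
    using C by (auto simp: romc_def)
  have D: "submc D" by (rule submc_iso[OF romc_submc[OF C] iso])
  note pos = f(8)
  have sums: "(\<Sum>s\<in>targets D. prob D (f q) s) = (\<Sum>s\<in>targets C. prob C q s)" if "q \<in> pos C" for q
    by (subst sum.reindex_bij_betw[OF f(4), symmetric]) (simp add: f(6) that)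
  have imm: "imm_exits D (map_sum id f a) = imm_exits C a" if "a \<in> {..<m} <+> pos C" for a
  proof -
    have "map_sum f id u = Inr j \<longleftrightarrow> u = Inr j" for u and j :: nat by (cases u) auto
    moreover have "prob D (f q) (Inr j) = prob C q (Inr j)" if "q \<in> pos C" "j < outs C" for q j
      using f(6)[OF that(1), of "Inr j"] that by simp
    ultimately show ?thesis
      using that f(1,2,5) C'(1) by (cases a) auto
  qed
  have "disjoint_family_on (imm_exits D) ({..<m} <+> pos D)"
    unfolding disjoint_family_on_def
  proof (intro ballI impI)
    fix a b assume ab: "a \<in> {..<m} <+> pos D" "b \<in> {..<m} <+> pos D" "a \<noteq> b"
    have "\<exists>a'\<in>{..<m} <+> pos C. a = map_sum id f a'" if "a \<in> {..<m} <+> pos D" for a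
      using that pos by (force simp: Plus_def)
    then obtain a' b' where a': "a' \<in> {..<m} <+> pos C" "a = map_sum id f a'"
      and b': "b' \<in> {..<m} <+> pos C" "b = map_sum id f b'"
      using ab by meson
    have "a' \<noteq> b'" using a'(2) b'(2) ab(3) by blast
    then have "imm_exits C a' \<inter> imm_exits C b' = {}"
      using disjoint_family_onD[OF C'(3) a'(1) b'(1)] by blast
    then show "imm_exits D a \<inter> imm_exits D b = {}"
      unfolding a'(2) b'(2) imm[OF a'(1)] imm[OF b'(1)] .
  qed
  then show ?thesis
    using submcD[OF D] C' f(1,2) sums unfolding romc_def by (auto simp: pos)
qed

lemma sem_iso:
  assumes C: "submc C" and iso: "romc_iso C D"
  shows "sem D = sem C"
proof -
  obtain f where "iso_via f C D" using iso by (auto simp: romc_iso_iff)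
  note f = iso_viaD[OF this]
  have reach: "reach D j (map_sum f id s) = reach C j s" if "s \<in> targets C" for s j
    unfolding reach_def val_def
  proof (rule sol_embed[OF _ _ _ that])
    fix s X assume s: "s \<in> targets C"
    then show "map_sum f id s \<in> targets D" using f(4) by (auto dest: bij_betwE)
    show "bnd (\<lambda>k. of_bool (k = j)) (map_sum f id s) = bnd (\<lambda>k. of_bool (k = j)) s"
      by (cases s) auto
    show "(\<Sum>t\<in>targets D. wt D (map_sum f id s) t * X t) = (\<Sum>t\<in>targets C. wt C s t * X (map_sum f id t))"
      using s by (subst sum.reindex_bij_betw[OF f(4), symmetric], cases s) (auto simp: f(6,7))
  qed
  show ?thesis
    using sem_entry[OF C] submcD(2)[OF C]
    by (intro sem_eqI submc_iso[OF C iso]) (auto simp: f(1,2,5) reach)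
qed

text \<open>The inverse bijection undoes \<open>f\<close> only on \<open>pos C\<close>, so the
  entrances of \<open>C\<close> must point into its targets to be recovered.\<close>

lemma romc_iso_sym:
  assumes iso: "romc_iso C D" and C: "\<And>i. i < ins C \<Longrightarrow> entr C i \<in> targets C"
  shows "romc_iso D C"
proof -
  obtain f where "iso_via f C D" using iso by (auto simp: romc_iso_iff)
  note f = iso_viaD[OF this]
  define g where "g = inv_into (pos C) f"
  have gf: "g (f q) = q" if "q \<in> pos C" for q
    using f(3) that by (simp add: g_def bij_betw_inv_into_left)
  have gf': "map_sum g id (map_sum f id s) = s" if "s \<in> targets C" for s
    using that gf by (cases s) auto
  note pos = f(8) and tar = f(9)
  show ?thesis
    unfolding romc_iso_def
    using f C gf gf' bij_betw_inv_into[OF f(3)]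
    by (intro conjI exI[of _ g]) (auto simp: pos tar g_def[symmetric])
qed

lemma romc_iso_trans:
  assumes "romc_iso C D" "romc_iso D E"
  shows "romc_iso C E"
proof -
  obtain f where "iso_via f C D" using assms(1) by (auto simp: romc_iso_iff)
  note f = iso_viaD[OF this]
  obtain g where "iso_via g D E" using assms(2) by (auto simp: romc_iso_iff)
  note g = iso_viaD[OF this]
  have gf: "map_sum (g \<circ> f) id s = map_sum g id (map_sum f id s)" for s :: "'a + nat"
    by (cases s) auto
  have "f q \<in> pos D" if "q \<in> pos C" for q using that f(3) by (auto dest: bij_betwE)
  moreover have "map_sum f id s \<in> targets D" if "s \<in> targets C" for s
    using that f(4) by (auto dest: bij_betwE)
  ultimately show ?thesis
    unfolding romc_iso_def using f g bij_betw_trans[OF f(3) g(3)]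
    by (intro conjI exI[of _ "g \<circ> f"]) (auto simp: gf)
qed

text \<open>Finitely many positions of any type can be renumbered by an initial segment of
  \<open>nat\<close>.\<close>

lemma iso_class_nonempty:
  assumes "finite (pos C)"
  shows "iso_class C \<noteq> {}"
proof -
  obtain f :: "'a \<Rightarrow> nat" where f: "bij_betw f (pos C) {0..<card (pos C)}"
    using ex_bij_betw_finite_nat[OF assms] by blast
  define g where "g = inv_into (pos C) f"
  have gf: "g (f q) = q" if "q \<in> pos C" for q
    using f that by (simp add: g_def bij_betw_inv_into_left)
  have gf': "map_sum g id (map_sum f id s) = s" if "s \<in> targets C" for s
    using that gf by (cases s) auto
  have "romc_iso C \<lparr>ins = ins C, outs = outs C, pos = {0..<card (pos C)},
      entr = map_sum f id \<circ> entr C, prob = (\<lambda>q s. prob C (g q) (map_sum g id s)), rwd = rwd C \<circ> g\<rparr>"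
    unfolding romc_iso_def using f by (intro conjI exI[of _ f]) (auto simp: gf gf')
  then show ?thesis by (auto simp: iso_class_def)
qed

lemma sem_MC_eqI: "X \<noteq> {} \<Longrightarrow> (\<And>C. C \<in> X \<Longrightarrow> sem C = y) \<Longrightarrow> sem_MC X = y"
proof -
  assume "X \<noteq> {}" "\<And>C. C \<in> X \<Longrightarrow> sem C = y"
  then have "sem ` X = {y}" by force
  then show ?thesis by (simp add: sem_MC_def)
qed

lemma sem_MC_iso_class: "submc C \<Longrightarrow> sem_MC (iso_class C) = sem C"
  by (intro sem_MC_eqI iso_class_nonempty) (auto simp: submcD iso_class_def sem_iso)

text \<open>Arrows are classes of chains over \<open>nat\<close>, so \<open>C\<close> is traded for
  a renumbered copy; symmetry and transitivity show that both have the same class.\<close>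

lemma iso_class_in_Hom:
  assumes C: "romc m n C"
  shows "iso_class C \<in> Hom roMC m n"
proof -
  obtain D where D: "romc_iso C D" and "D \<in> iso_class C"
    using iso_class_nonempty[of C] C by (auto simp: romc_def iso_class_def)
  have "romc_iso D C"
    using C by (intro romc_iso_sym[OF D]) (auto simp: romc_def)
  then have "iso_class C = iso_class D"
    using D by (auto simp: iso_class_def intro: romc_iso_trans)
  then show ?thesis using romc_of_iso[OF C D] by (auto simp: roMC_def)
qed

lemma HomD:
  assumes "X \<in> Hom roMC m n"
  shows "X \<noteq> {}" "C \<in> X \<Longrightarrow> romc m n C" "C \<in> X \<Longrightarrow> sem_MC X = sem C"
proof -
  obtain D :: "nat omc" where D: "X = iso_class D" "romc m n D"
    using assms unfolding roMC_def by auto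
  show "X \<noteq> {}" using D iso_class_nonempty by (auto simp: romc_def)
  show "romc m n C" if "C \<in> X" using that D romc_of_iso by (auto simp: iso_class_def)
  show "sem_MC X = sem C" if "C \<in> X"
    using that D sem_MC_iso_class[OF romc_submc[OF D(2)]] sem_iso[OF romc_submc[OF D(2)], of C]
    by (simp add: iso_class_def)
qed

text \<open>The form in which the operations on classes are evaluated. Isomorphic representatives
  have equal semantics and the semantics of a result is a function of those of its arguments, so it
  is constant on the union.\<close>

lemma sem_MC_UN_iso_class:
  assumes "I \<noteq> {}" "\<And>x. x \<in> I \<Longrightarrow> submc (F x)" "\<And>x. x \<in> I \<Longrightarrow> sem (F x) = y"
  shows "sem_MC (\<Union>x\<in>I. iso_class (F x)) = y"
proof (rule sem_MC_eqI)
  show "(\<Union>x\<in>I. iso_class (F x)) \<noteq> {}"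
  proof -
    obtain x where "x \<in> I" using assms(1) by blast
    then show ?thesis using iso_class_nonempty[OF submcD(1)[OF assms(2)], of x] by blast
  qed
  show "sem C = y" if C: "C \<in> (\<Union>x\<in>I. iso_class (F x))" for C
  proof -
    obtain x where "x \<in> I" "romc_iso (F x) C" using C by (auto simp: iso_class_def)
    then show ?thesis using sem_iso[OF assms(2)] assms(3) by metis
  qed
qed

section \<open>Identities, swaps, sums and sequential composition\<close>

lemma sum_lessThan_add:
  fixes g :: "nat \<Rightarrow> 'a::comm_monoid_add"
  shows "(\<Sum>k<a + b. g k) = (\<Sum>k<a. g k) + (\<Sum>k<b. g (a + k))"
  by (induction b) (simp_all add: ac_simps)

lemma submc_id: "submc (id_romc n)" and submc_swap: "submc (swap_romc m n)"
  by (auto simp: submc_def id_romc_def swap_romc_def targets_def)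

lemma sem_id: "sem (id_romc n) = smc_id n"
proof (rule sem_eqI[OF submc_id])
  fix i j assume "i < ins (id_romc n)" "j < outs (id_romc n)"
  then show "fst (smc_id n) $$ (i, j) \<ge> 0 \<and> snd (smc_id n) $$ (i, j) \<ge> 0 \<and>
      reach (id_romc n) j (entr (id_romc n) i) = dn (fst (smc_id n) $$ (i, j)) (snd (smc_id n) $$ (i, j))"
    using reach_Inr[of i "id_romc n" j] by (auto simp: id_romc_def smc_id_def)
qed (auto simp: id_romc_def smc_id_def)

lemma sem_swap: "sem (swap_romc m n) = smc_swap m n"
proof (rule sem_eqI[OF submc_swap])
  fix i j assume "i < ins (swap_romc m n)" "j < outs (swap_romc m n)"
  then show "fst (smc_swap m n) $$ (i, j) \<ge> 0 \<and> snd (smc_swap m n) $$ (i, j) \<ge> 0 \<and>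
      reach (swap_romc m n) j (entr (swap_romc m n) i) =
        dn (fst (smc_swap m n) $$ (i, j)) (snd (smc_swap m n) $$ (i, j))"
    using reach_Inr[of "if i < m then i + n else i - m" "swap_romc m n" j]
    by (auto simp: swap_romc_def smc_swap_def)
qed (auto simp: swap_romc_def smc_swap_def)

section \<open>Disjoint sums\<close>

lemma sum_romc_simps [simp]:
  "ins (sum_romc C D) = ins C + ins D" "outs (sum_romc C D) = outs C + outs D"
  "pos (sum_romc C D) = pos C <+> pos D"
  by (simp_all add: sum_romc_def)

lemma sum_targets_sum_romc:
  fixes f :: "('q + 'r) + nat \<Rightarrow> 'a::comm_monoid_add"
  assumes "finite (pos C)" "finite (pos D)"
  shows "(\<Sum>s\<in>targets (sum_romc C D). f s) =
    (\<Sum>t\<in>targets C. f (map_sum Inl id t)) + (\<Sum>t\<in>targets D. f (map_sum Inr (\<lambda>j. j + outs C) t))"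
  using assms by (simp add: sum_targets sum.Plus sum_lessThan_add ac_simps)

text \<open>No transition crosses between the two halves, so each half is an embedded copy of its
  own system; the second sees its exits shifted.\<close>

lemma val_sum_romc:
  assumes "finite (pos C)" "finite (pos D)"
  shows "t \<in> targets C \<Longrightarrow> val (sum_romc C D) b (map_sum Inl id t) = val C b t"
    and "u \<in> targets D \<Longrightarrow> val (sum_romc C D) b (map_sum Inr (\<lambda>j. j + outs C) u) =
      val D (\<lambda>k. b (k + outs C)) u"
proof -
  note simps = sum_targets_sum_romc[OF assms]
  assume "t \<in> targets C"
  then show "val (sum_romc C D) b (map_sum Inl id t) = val C b t"
    unfolding val_def
  proof (rule sol_embed[rotated 3])
    fix s X assume s: "s \<in> targets C"
    show "map_sum Inl id s \<in> targets (sum_romc C D)" "bnd b (map_sum Inl id s) = bnd b s"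
      using s by (cases s; auto)+
    have "wt (sum_romc C D) (map_sum Inl id s) (map_sum Inl id t) = wt C s t" if "t \<in> targets C" for t
      using that s by (cases s; cases t) (auto simp: sum_romc_def)
    moreover have "wt (sum_romc C D) (map_sum Inl id s) (map_sum Inr (\<lambda>j. j + outs C) t) = 0" for t
      using s by (cases s; cases t) (auto simp: sum_romc_def)
    ultimately show "(\<Sum>t\<in>targets (sum_romc C D). wt (sum_romc C D) (map_sum Inl id s) t * X t) =
        (\<Sum>t\<in>targets C. wt C s t * X (map_sum Inl id t))"
      unfolding simps by simp
  qed
next
  note simps = sum_targets_sum_romc[OF assms]
  let ?f = "map_sum Inr (\<lambda>j. j + outs C)"
  assume "u \<in> targets D"
  then show "val (sum_romc C D) b (?f u) = val D (\<lambda>k. b (k + outs C)) u"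
    unfolding val_def
  proof (rule sol_embed[rotated 3])
    fix s X assume s: "s \<in> targets D"
    show "?f s \<in> targets (sum_romc C D)" "bnd b (?f s) = bnd (\<lambda>k. b (k + outs C)) s"
      using s by (cases s; auto)+
    have "wt (sum_romc C D) (?f s) (?f t) = wt D s t" if "t \<in> targets D" for t
      using that s by (cases s; cases t) (auto simp: sum_romc_def)
    moreover have "wt (sum_romc C D) (?f s) (map_sum Inl id t) = 0" if "t \<in> targets C" for t
      using that s by (cases s; cases t) (auto simp: sum_romc_def)
    ultimately show "(\<Sum>t\<in>targets (sum_romc C D). wt (sum_romc C D) (?f s) t * X t) =
        (\<Sum>t\<in>targets D. wt D s t * X (?f t))"
      unfolding simps by simp
  qed
qed

lemma submc_sum:
  assumes C: "submc C" and D: "submc D"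
  shows "submc (sum_romc C D)"
proof -
  note CD = submcD[OF C] submcD[OF D]
  let ?S = "sum_romc C D"
  have prob_l: "prob ?S (Inl q) (map_sum Inl id t) = prob C q t"
    and prob_r: "prob ?S (Inr r) (map_sum Inl id t) = 0" if "t \<in> targets C" for q r t
    using that by (cases t; simp add: sum_romc_def)+
  have "entr ?S i \<in> targets ?S" if "i < ins C + ins D" for i
  proof (cases "i < ins C")
    case True
    then show ?thesis using CD(2)[OF True] by (cases "entr C i") (auto simp: sum_romc_def)
  next
    case False
    then have "entr D (i - ins C) \<in> targets D" using that by (intro CD(8)) simp
    then show ?thesis using False by (cases "entr D (i - ins C)") (auto simp: sum_romc_def)
  qed
  moreover have "prob ?S u s \<ge> 0" if "u \<in> pos ?S" "s \<in> targets ?S" for u s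
  proof (cases s)
    case (Inl a)
    then show ?thesis
      using that CD(3)[of _ "Inl _"] CD(9)[of _ "Inl _"] by (cases u; cases a) (auto simp: sum_romc_def)
  next
    case (Inr k)
    then show ?thesis
      using that CD(3)[of _ "Inr k"] CD(9)[of _ "Inr (k - outs C)"] by (cases u) (auto simp: sum_romc_def)
  qed
  moreover have "(\<Sum>s\<in>targets ?S. prob ?S u s) \<le> 1" if "u \<in> pos ?S" for u
  proof (cases u)
    case (Inl q)
    have "prob ?S (Inl q) (map_sum Inr (\<lambda>j. j + outs C) t) = 0" for t
      by (cases t) (auto simp: sum_romc_def)
    then show ?thesis
      using that CD(4) Inl by (auto simp: sum_targets_sum_romc CD(1,7) prob_l)
  next
    case (Inr r)
    have "prob ?S (Inr r) (map_sum Inr (\<lambda>j. j + outs C) t) = prob D r t" for t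
      by (cases t) (auto simp: sum_romc_def)
    then show ?thesis
      using that CD(10) Inr by (auto simp: sum_targets_sum_romc CD(1,7) prob_r)
  qed
  moreover have "rwd ?S u \<ge> 0" if "u \<in> pos ?S" for u
    using that CD(5,11) by (auto simp: sum_romc_def)
  ultimately show ?thesis
    using CD(1,7) by (auto simp: submc_def)
qed

lemma sem_sum:
  assumes C: "submc C" and D: "submc D"
  shows "sem (sum_romc C D) = smc_sum (sem C) (sem D)"
proof (rule sem_eqI[OF submc_sum[OF C D]])
  fix i j assume ij: "i < ins (sum_romc C D)" "j < outs (sum_romc C D)"
  note val = val_sum_romc[OF submcD(1)[OF C] submcD(1)[OF D]]
  \<comment> \<open>This yields the zero off-diagonal blocks: the indicator of an exit of one
    summand vanishes on all exits of the other.\<close>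
  have zero: "val E b s = 0" if "\<And>k. k < outs E \<Longrightarrow> b k = 0" for E :: "'x omc" and b s
    using that by (simp add: val_eq_sum_reach)
  have "reach (sum_romc C D) j (entr (sum_romc C D) i) =
    (if i < ins C then if j < outs C then reach C j (entr C i) else 0
     else if j < outs C then 0 else reach D (j - outs C) (entr D (i - ins C)))"
  proof (cases "i < ins C")
    case True
    then have "reach (sum_romc C D) j (entr (sum_romc C D) i) = val C (\<lambda>k. of_bool (k = j)) (entr C i)"
      using submcD(2)[OF C True] unfolding reach_def by (subst val(1)[symmetric]) (auto simp: sum_romc_def)
    then show ?thesis using True zero[of C "\<lambda>k. of_bool (k = j)"] by (auto simp: reach_def)
  next
    case False
    then have "entr D (i - ins C) \<in> targets D" using ij by (intro submcD(2)[OF D]) auto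
    then have "reach (sum_romc C D) j (entr (sum_romc C D) i) =
        val D (\<lambda>k. of_bool (k + outs C = j)) (entr D (i - ins C))"
      using False unfolding reach_def by (subst val(2)[symmetric]) (auto simp: sum_romc_def)
    moreover have "(k + outs C = j) = (k = j - outs C)" if "\<not> j < outs C" for k
      using that by auto
    ultimately show ?thesis
      using False zero[of D "\<lambda>k. of_bool (k + outs C = j)"] by (auto simp: reach_def)
  qed
  then show "fst (smc_sum (sem C) (sem D)) $$ (i, j) \<ge> 0 \<and> snd (smc_sum (sem C) (sem D)) $$ (i, j) \<ge> 0 \<and>
      reach (sum_romc C D) j (entr (sum_romc C D) i) =
        dn (fst (smc_sum (sem C) (sem D)) $$ (i, j)) (snd (smc_sum (sem C) (sem D)) $$ (i, j))"
    using ij sem_entry[OF C] sem_entry[OF D] by (auto simp: smc_sum_def block_diag_def)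
qed (auto simp: smc_sum_def block_diag_def)

section \<open>Sequential composition\<close>

lemma seq_romc_simps [simp]:
  "ins (seq_romc C D) = ins C" "outs (seq_romc C D) = outs D" "pos (seq_romc C D) = pos C <+> pos D"
  "rwd (seq_romc C D) = case_sum (rwd C) (rwd D)"
  by (simp_all add: seq_romc_def)

lemma prob_seq_romc [simp]:
  "prob (seq_romc C D) (Inl q) (Inl (Inl q')) = prob C q (Inl q')"
  "prob (seq_romc C D) (Inl q) (map_sum Inr id t) =
    (\<Sum>k<outs C. prob C q (Inr k) * of_bool (entr D k = t))"
  "prob (seq_romc C D) (Inr r) (Inl (Inl q')) = 0"
  "prob (seq_romc C D) (Inr r) (map_sum Inr id t) = prob D r t"
  by (cases t; simp add: seq_romc_def)+

lemma sum_targets_seq_romc: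
  fixes f :: "('q + 'r) + nat \<Rightarrow> 'a::comm_monoid_add"
  assumes "finite (pos C)" "finite (pos D)"
  shows "(\<Sum>s\<in>targets (seq_romc C D). f s) =
    (\<Sum>q\<in>pos C. f (Inl (Inl q))) + (\<Sum>t\<in>targets D. f (map_sum Inr id t))"
  using assms by (simp add: sum_targets sum.Plus ac_simps)

lemma targets_seq_romc_cases:
  assumes "s \<in> targets (seq_romc C D)"
  obtains q where "q \<in> pos C" "s = Inl (Inl q)" | t where "t \<in> targets D" "s = map_sum Inr id t"
proof (cases s)
  case (Inl a)
  then show thesis
    using assms that(1) that(2)[of "Inl _"] by (cases a) auto
next
  case (Inr k)
  then show thesis using assms that(2)[of "Inr k"] by auto
qed

text \<open>Where a target of the first chain continues in the composite: an exit \<open>k\<close>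
  is identified with whatever entrance \<open>k\<close> of \<open>D\<close> leads to.\<close>

definition seq_emb :: "'r omc \<Rightarrow> 'q + nat \<Rightarrow> ('q + 'r) + nat" where
  "seq_emb D s = (case s of Inl q \<Rightarrow> Inl (Inl q) | Inr k \<Rightarrow> map_sum Inr id (entr D k))"

lemma seq_emb_simps [simp]:
  "seq_emb D (Inl q) = Inl (Inl q)" "seq_emb D (Inr k) = map_sum Inr id (entr D k)"
  by (simp_all add: seq_emb_def)

lemma entr_seq_romc: "entr (seq_romc C D) i = seq_emb D (entr C i)"
  by (simp add: seq_romc_def seq_emb_def)

lemma seq_emb_in_targets:
  assumes "submc D" "outs C = ins D" "s \<in> targets C"
  shows "seq_emb D s \<in> targets (seq_romc C D)"
proof (cases s)
  case (Inr k)
  then have "entr D k \<in> targets D" using assms by (intro submcD(2)) auto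
  then show ?thesis using Inr by (cases "entr D k") auto
qed (use assms in auto)

lemma sum_of_bool_eq:
  fixes f :: "'a \<Rightarrow> 'b::semiring_1"
  assumes "finite T" "a \<in> T"
  shows "(\<Sum>t\<in>T. of_bool (a = t) * f t) = f a"
proof -
  have "(\<Sum>t\<in>T. of_bool (a = t) * f t) = (\<Sum>t\<in>T. if t = a then f t else 0)"
    by (intro sum.cong) auto
  then show ?thesis using assms by simp
qed

lemma submc_seq:
  assumes C: "submc C" and D: "submc D" and CD: "outs C = ins D"
  shows "submc (seq_romc C D)"
proof -
  note Cs = submcD[OF C] and Ds = submcD[OF D]
  let ?S = "seq_romc C D"
  have "entr ?S i \<in> targets ?S" if "i < ins ?S" for i
    using that Cs(2) seq_emb_in_targets[OF D CD] by (simp add: entr_seq_romc)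
  moreover have "prob ?S u s \<ge> 0" if u: "u \<in> pos ?S" and s: "s \<in> targets ?S" for u s
    using s
  proof (cases rule: targets_seq_romc_cases)
    case (1 q)
    then show ?thesis using u Cs(3) by (cases u) auto
  next
    case (2 t)
    then show ?thesis using u Cs(3) Ds(3) by (cases u) (auto intro!: sum_nonneg)
  qed
  moreover have "(\<Sum>s\<in>targets ?S. prob ?S u s) \<le> 1" if u: "u \<in> pos ?S" for u
  proof (cases u)
    case (Inl q)
    \<comment> \<open>Each exit of \<open>C\<close> continues to exactly one target of
      \<open>D\<close>, so summing over these targets gives back the mass leaving through the
      exits.\<close>
    have "(\<Sum>t\<in>targets D. \<Sum>k<outs C. prob C q (Inr k) * of_bool (entr D k = t)) =
        (\<Sum>k<outs C. prob C q (Inr k) * (\<Sum>t\<in>targets D. of_bool (entr D k = t) * 1))"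
      unfolding sum_distrib_left by (subst sum.swap) simp
    also have "\<dots> = (\<Sum>k<outs C. prob C q (Inr k))"
    proof (intro sum.cong refl)
      fix k assume "k \<in> {..<outs C}"
      then show "prob C q (Inr k) * (\<Sum>t\<in>targets D. of_bool (entr D k = t) * 1) = prob C q (Inr k)"
        using Ds(2)[of k] CD by (subst sum_of_bool_eq[OF Ds(6)]) auto
    qed
    finally show ?thesis
      using Inl u Cs(4)[of q] by (auto simp: sum_targets_seq_romc Cs(1) Ds(1) sum_targets[OF Cs(1)])
  next
    case (Inr r)
    then show ?thesis
      using u Ds(4)[of r] by (auto simp: sum_targets_seq_romc Cs(1) Ds(1))
  qed
  moreover have "rwd ?S u \<ge> 0" if "u \<in> pos ?S" for u
    using that Cs(5) Ds(5) by auto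
  ultimately show ?thesis
    using Cs(1) Ds(1) by (auto simp: submc_def)
qed

lemma reach_seq_romc_right:
  assumes "finite (pos C)" "finite (pos D)" "t \<in> targets D"
  shows "reach (seq_romc C D) j (map_sum Inr id t) = reach D j t"
  unfolding reach_def val_def
proof (rule sol_embed[OF _ _ _ assms(3)])
  fix s X assume s: "s \<in> targets D"
  show "map_sum Inr id s \<in> targets (seq_romc C D)"
    "bnd (\<lambda>k. of_bool (k = j)) (map_sum Inr id s) = bnd (\<lambda>k. of_bool (k = j)) s"
    using s by (cases s; auto)+
  show "(\<Sum>t\<in>targets (seq_romc C D). wt (seq_romc C D) (map_sum Inr id s) t * X t) =
      (\<Sum>t\<in>targets D. wt D s t * X (map_sum Inr id t))"
    unfolding sum_targets_seq_romc[OF assms(1,2)] by (cases s) simp_all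
qed

text \<open>The row of a position of \<open>C\<close> in the composite is its old row pushed forward
  along \<open>seq_emb\<close>. Several exits may share a target of \<open>D\<close>; exchanging the
  sums over exits and targets absorbs this.\<close>

lemma sum_wt_seq_romc:
  assumes C: "submc C" and D: "submc D" and CD: "outs C = ins D" and q: "q \<in> pos C"
  shows "(\<Sum>s\<in>targets (seq_romc C D). wt (seq_romc C D) (Inl (Inl q)) s * X s) =
    (\<Sum>s\<in>targets C. wt C (Inl q) s * X (seq_emb D s))"
proof -
  note Cs = submcD[OF C] and Ds = submcD[OF D]
  have of_bool: "of_bool P = dn (of_bool P) 0" for P by (cases P) auto
  have wt: "wt (seq_romc C D) (Inl (Inl q)) (map_sum Inr id t) =
      (\<Sum>k<outs C. wt C (Inl q) (Inr k) * of_bool (entr D k = t))" for t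
  proof -
    have "(\<Sum>k<outs C. wt C (Inl q) (Inr k) * of_bool (entr D k = t)) =
        (\<Sum>k<outs C. dn (prob C q (Inr k) * of_bool (entr D k = t))
          (prob C q (Inr k) * of_bool (entr D k = t) * rwd C q))"
      using Cs(3,5) q by (intro sum.cong refl) (subst of_bool, simp add: dn_mult)
    also have "\<dots> = wt (seq_romc C D) (Inl (Inl q)) (map_sum Inr id t)"
      unfolding wt_simps prob_seq_romc seq_romc_simps sum.case sum_distrib_right
      using Cs(3,5) q by (intro dn_sum) auto
    finally show ?thesis by simp
  qed
  have "(\<Sum>t\<in>targets D. wt (seq_romc C D) (Inl (Inl q)) (map_sum Inr id t) * X (map_sum Inr id t)) =
      (\<Sum>k<outs C. wt C (Inl q) (Inr k) * (\<Sum>t\<in>targets D. of_bool (entr D k = t) * X (map_sum Inr id t)))"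
    unfolding wt sum_distrib_left sum_distrib_right by (subst sum.swap) (simp add: mult.assoc)
  also have "\<dots> = (\<Sum>k<outs C. wt C (Inl q) (Inr k) * X (seq_emb D (Inr k)))"
    using Ds(2) CD by (intro sum.cong refl) (subst sum_of_bool_eq[OF Ds(6)], auto)
  finally show ?thesis
    unfolding sum_targets_seq_romc[OF Cs(1) Ds(1)] sum_targets[OF Cs(1)] by simp
qed

text \<open>On the part coming from \<open>C\<close>, the composite is the system of
  \<open>C\<close> with the values of \<open>D\<close> at its entrances as boundary values. Pulling
  the composite solution back along \<open>seq_emb\<close> gives a presolution for \<open>C\<close>,
  and gluing the solutions of both chains gives one for the composite.\<close>

lemma reach_seq_romc:
  assumes C: "submc C" and D: "submc D" and CD: "outs C = ins D" and s: "s \<in> targets C"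
  shows "reach (seq_romc C D) j (seq_emb D s) = val C (\<lambda>k. reach D j (entr D k)) s"
proof -
  note Cs = submcD[OF C] and Ds = submcD[OF D]
  let ?b = "\<lambda>k. reach D j (entr D k)"
  have right: "reach (seq_romc C D) j (map_sum Inr id t) = reach D j t" if "t \<in> targets D" for t
    by (rule reach_seq_romc_right[OF Cs(1) Ds(1) that])
  have entr: "entr D k \<in> targets D" if "k < outs C" for k
    using that CD Ds(2) by simp
  have ge: "val C ?b s \<le> reach (seq_romc C D) j (seq_emb D s)" for s
  proof (rule val_least)
    fix q assume q: "q \<in> pos C"
    then have "Inl q \<in> pos (seq_romc C D)" by auto
    from reach_Inl[OF this, of j]
    show "(\<Sum>s\<in>targets C. wt C (Inl q) s * reach (seq_romc C D) j (seq_emb D s))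
        \<le> reach (seq_romc C D) j (seq_emb D (Inl q))"
      unfolding sum_wt_seq_romc[OF C D CD q] by simp
  qed (simp add: right entr)
  define Y where "Y = case_sum (case_sum (\<lambda>q. val C ?b (Inl q)) (\<lambda>r. reach D j (Inl r)))
    (\<lambda>k. reach D j (Inr k))"
  have Y_right: "Y (map_sum Inr id t) = reach D j t" for t by (cases t) (auto simp: Y_def)
  have Y_emb: "Y (seq_emb D s) = val C ?b s" if "s \<in> targets C" for s
    using that by (cases s) (simp add: Y_def, simp add: Y_right)
  have "reach (seq_romc C D) j s \<le> Y s" for s
    unfolding reach_def
  proof (rule val_least)
    fix u assume u: "u \<in> pos (seq_romc C D)"
    show "(\<Sum>s\<in>targets (seq_romc C D). wt (seq_romc C D) (Inl u) s * Y s) \<le> Y (Inl u)"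
    proof (cases u)
      case (Inl q)
      then have q: "q \<in> pos C" using u by auto
      show ?thesis
        unfolding Inl sum_wt_seq_romc[OF C D CD q]
        using val_Inl[OF q, of ?b] Y_emb[of "Inl q"] q by (simp add: Y_emb del: wt_simps)
    next
      case (Inr r)
      then have "r \<in> pos D" using u by auto
      then show ?thesis
        unfolding Inr sum_targets_seq_romc[OF Cs(1) Ds(1)]
        using reach_Inl[of r D j] by (simp add: Y_right) (simp add: Y_def)
    qed
  qed (simp add: Y_def)
  then have "reach (seq_romc C D) j (seq_emb D s) \<le> val C ?b s"
    using Y_emb[OF s] by metis
  then show ?thesis using ge by (intro antisym)
qed

lemma index_mult_mat_sum:
  assumes "i < dim_row A" "j < dim_col B" "dim_col A = dim_row B"
  shows "(A * B) $$ (i, j) = (\<Sum>k<dim_row B. A $$ (i, k) * B $$ (k, j))"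
  using assms by (simp add: scalar_prod_def lessThan_atLeast0)

lemma sem_seq:
  assumes C: "submc C" and D: "submc D" and CD: "outs C = ins D"
  shows "sem (seq_romc C D) = smc_seq (sem C) (sem D)"
proof (rule sem_eqI[OF submc_seq[OF C D CD]])
  fix i j assume "i < ins (seq_romc C D)" "j < outs (seq_romc C D)"
  then have ij: "i < ins C" "j < outs D" by auto
  let ?P = "\<lambda>k. fst (sem C) $$ (i, k)" and ?R = "\<lambda>k. snd (sem C) $$ (i, k)"
  let ?P' = "\<lambda>k. fst (sem D) $$ (k, j)" and ?R' = "\<lambda>k. snd (sem D) $$ (k, j)"
  have nn: "?P k \<ge> 0" "?R k \<ge> 0" "?P' k \<ge> 0" "?R' k \<ge> 0" if "k < ins D" for k
    using that ij CD sem_entry[OF C] sem_entry[OF D] by auto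
  have P: "fst (smc_seq (sem C) (sem D)) $$ (i, j) = (\<Sum>k<ins D. ?P k * ?P' k)"
    and R: "snd (smc_seq (sem C) (sem D)) $$ (i, j) = (\<Sum>k<ins D. ?P k * ?R' k + ?R k * ?P' k)"
    using ij CD by (simp_all add: smc_seq_def index_mult_mat_sum sum.distrib del: index_mult_mat(1))
  have "reach (seq_romc C D) j (entr (seq_romc C D) i) = val C (\<lambda>k. reach D j (entr D k)) (entr C i)"
    unfolding entr_seq_romc by (rule reach_seq_romc[OF C D CD submcD(2)[OF C ij(1)]])
  also have "\<dots> = (\<Sum>k<ins D. dn (?P k) (?R k) * dn (?P' k) (?R' k))"
    unfolding val_eq_sum_reach CD
    using ij CD by (intro sum.cong refl) (simp add: sem_entry(3)[OF C] sem_entry(3)[OF D] mult.commute)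
  also have "\<dots> = (\<Sum>k<ins D. dn (?P k * ?P' k) (?P k * ?R' k + ?R k * ?P' k))"
    using nn by (intro sum.cong refl dn_mult) auto
  also have "\<dots> = dn (\<Sum>k<ins D. ?P k * ?P' k) (\<Sum>k<ins D. ?P k * ?R' k + ?R k * ?P' k)"
    using nn by (intro dn_sum) auto
  finally show "fst (smc_seq (sem C) (sem D)) $$ (i, j) \<ge> 0 \<and> snd (smc_seq (sem C) (sem D)) $$ (i, j) \<ge> 0 \<and>
      reach (seq_romc C D) j (entr (seq_romc C D) i) =
        dn (fst (smc_seq (sem C) (sem D)) $$ (i, j)) (snd (smc_seq (sem C) (sem D)) $$ (i, j))"
    unfolding P R using nn by (auto intro!: sum_nonneg)
qed (auto simp: smc_seq_def CD)

section \<open>The trace\<close>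

text \<open>Finiteness of the limit is known beforehand and is what makes the two real series
  converge.\<close>

lemma suminf_dnum:
  assumes "\<And>d. p d \<ge> 0" "\<And>d. r d \<ge> 0" and z: "z = dsup (\<lambda>n. \<Sum>d<n. dn (p d) (r d))"
    and fin: "base z < \<infinity>" "eps z < \<infinity>"
  shows "summable p" "summable r" "z = dn (suminf p) (suminf r)"
proof -
  have base: "base z = (\<Sum>d. ennreal (p d))" and eps: "eps z = (\<Sum>d. ennreal (r d))"
    by (simp_all only: z dsup_def dnum.sel base_sum eps_sum base_dn eps_dn suminf_eq_SUP)
  show p: "summable p"
    using assms(1) by (rule summable_suminf_not_top) (use fin base in auto)
  show r: "summable r"
    using assms(2) by (rule summable_suminf_not_top) (use fin eps in auto)
  show "z = dn (suminf p) (suminf r)"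
    using suminf_ennreal2[OF assms(1) p] suminf_ennreal2[OF assms(2) r]
    by (intro dnum.expand) (simp add: base eps)
qed

text \<open>\<open>^\<^sub>m\<close> unfolds on the right, whereas \<open>orbit\<close> applies the
  matrix on the left.\<close>

lemma pow_mat_Suc_left:
  assumes A: "A \<in> carrier_mat k k"
  shows "A ^\<^sub>m Suc d = A * A ^\<^sub>m d"
proof (induction d)
  case 0
  then show ?case using A by simp
next
  case (Suc d)
  have "A ^\<^sub>m Suc (Suc d) = (A * A ^\<^sub>m d) * A" using Suc by simp
  also have "\<dots> = A * A ^\<^sub>m Suc d"
    using A by (simp add: assoc_mult_mat[OF A pow_carrier_mat[OF A] A])
  finally show ?case .
qed

locale feedback =
  fixes C :: "'q omc" and l m n :: nat
  assumes romc: "romc (l + m) (l + n) C"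
begin

abbreviation "T \<equiv> trace_romc l m n C"

text \<open>Embeds the targets of the traced chain into those of \<open>C\<close>; what it misses
  are exactly the exits in [l].\<close>

definition shift :: "'q + nat \<Rightarrow> 'q + nat" where
  "shift = map_sum id (\<lambda>k. k + l)"

lemma shift_simps [simp]: "shift (Inl q) = Inl q" "shift (Inr k) = Inr (k + l)"
  by (simp_all add: shift_def)

lemma inj_shift: "shift s = shift t \<longleftrightarrow> s = t"
  by (cases s; cases t) auto

lemma submc: "submc C"
  by (rule romc_submc[OF romc])

lemma ins [simp]: "ins C = l + m" and outs [simp]: "outs C = l + n"
  using romc by (auto simp: romc_def)

lemmas CD = submcD[OF submc]

lemma T_simps [simp]: "ins T = m" "outs T = n" "pos T = pos C" "rwd T = rwd C"
  by (simp_all add: trace_romc_def)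

lemma prob_T: "prob T q s = prob C q (shift s) + (\<Sum>k\<in>prec C l (shift s). prob C q (Inr k))"
  by (cases s) (simp_all add: trace_romc_def)

lemma finite_T: "finite (targets T)"
  using CD(1) by (simp add: targets_def)

lemma shift_targets [simp]: "shift s \<in> targets C \<longleftrightarrow> s \<in> targets T"
  by (cases s) auto

lemma targets_cases:
  assumes "u \<in> targets C"
  obtains k where "k < l" "u = Inr k" | s where "s \<in> targets T" "u = shift s"
proof (cases u)
  case (Inl q)
  then show thesis using assms that(2)[of u] by simp
next
  case (Inr k)
  then show thesis
    using assms that(1)[of k] that(2)[of "Inr (k - l)"] by (cases "k < l") auto
qed

lemma sum_targets_C:
  fixes f :: "'q + nat \<Rightarrow> 'a::comm_monoid_add"
  shows "(\<Sum>s\<in>targets C. f s) = (\<Sum>s\<in>targets T. f (shift s)) + (\<Sum>k<l. f (Inr k))"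
  using CD(1) by (simp add: sum_targets sum_lessThan_add ac_simps)

section \<open>Landing points of feedback chains\<close>

lemma lands_unique: "lands C l i t \<Longrightarrow> lands C l i t' \<Longrightarrow> t = t'"
proof (induction arbitrary: t' rule: lands.induct)
  case (stop i t)
  from stop(3) stop(1,2) show ?case by cases auto
next
  case (step i k t)
  from step(5) step(1,2,4) show ?case by cases auto
qed

lemma lands_step_iff: "entr C i = Inr k \<Longrightarrow> k < l \<Longrightarrow> lands C l i t \<longleftrightarrow> lands C l k t"
  by (subst lands.simps) auto

lemma lands_shift:
  assumes "lands C l i t" "i < l + m"
  obtains s where "s \<in> targets T" "t = shift s"
proof -
  have "\<exists>s\<in>targets T. t = shift s"
    using assms
  proof (induction rule: lands.induct)
    case (stop i t)
    then have "t \<in> targets C" using CD(2)[of i] by simp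
    then show ?case using stop(2) by (cases rule: targets_cases) auto
  qed auto
  then show thesis using that by blast
qed

text \<open>The disjointness of immediately reachable exits, read off at entrances: this is what
  excludes a loop with an access from outside.\<close>

lemma entr_inj:
  assumes "i < l + m" "i' < l + m" "entr C i = Inr k" "entr C i' = Inr k" "k < l"
  shows "i = i'"
proof (rule ccontr)
  assume "i \<noteq> i'"
  have "disjoint_family_on (imm_exits C) ({..<l + m} <+> pos C)"
    using romc by (simp add: romc_def)
  then have "imm_exits C (Inl i) \<inter> imm_exits C (Inl i') = {}"
    by (rule disjoint_family_onD) (use assms(1,2) \<open>i \<noteq> i'\<close> in auto)
  moreover have "k \<in> imm_exits C (Inl i)" "k \<in> imm_exits C (Inl i')" using assms by simp_all
  ultimately show False by blast
qed

text \<open>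
  The entrances in \<open>[l]\<close> that never land are permuted by \<open>E\<close>, so none of them is the exit of an
  entrance outside \<open>[l]\<close>.
\<close>

lemma lands_exists:
  assumes i: "i < m"
  shows "\<exists>t. lands C l (i + l) t"
proof (rule ccontr)
  assume not: "\<nexists>t. lands C l (i + l) t"
  define B where "B = {k. k < l \<and> (\<nexists>t. lands C l k t)}"
  define e where "e k = projr (entr C k)" for k
  have e: "entr C k = Inr (e k) \<and> e k \<in> B" if "\<nexists>t. lands C l k t" for k
  proof -
    from that have "entr C k \<in> Inr ` {..<l}" by (auto intro: lands.stop)
    then obtain k' where k': "entr C k = Inr k'" "k' < l" by auto
    then show ?thesis using that lands_step_iff[OF k'] by (auto simp: e_def B_def)
  qed
  have B: "entr C k = Inr (e k)" "e k \<in> B" if "k \<in> B" for k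
    using e[of k] that by (auto simp: B_def)
  have "finite B" by (simp add: B_def)
  moreover have "e ` B \<subseteq> B" using B(2) by auto
  moreover have "inj_on e B"
  proof (rule inj_onI)
    fix k k' assume k: "k \<in> B" "k' \<in> B" "e k = e k'"
    have "k < l" "k' < l" "e k < l" using k(1,2) B(2)[OF k(1)] by (simp_all add: B_def)
    then show "k = k'"
      using entr_inj[of k k' "e k"] B(1)[OF k(1)] B(1)[OF k(2)] k(3) by simp
  qed
  ultimately have "e ` B = B" by (rule endo_inj_surj)
  then obtain k where k: "k \<in> B" "e k = e (i + l)" using e[OF not] by (metis imageE)
  have "k < l" "e k < l" using k(1) B(2)[OF k(1)] by (simp_all add: B_def)
  then have "k = i + l"
    using entr_inj[of k "i + l" "e k"] B(1)[OF k(1)] e[OF not] k(2) i by simp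
  then show False using \<open>k < l\<close> by simp
qed

lemma entr_T:
  assumes i: "i < m"
  shows "lands C l (i + l) (shift (entr T i))" "entr T i \<in> targets T"
proof -
  obtain t where t: "lands C l (i + l) t" using lands_exists[OF i] by blast
  obtain s where s: "s \<in> targets T" "t = shift s" by (rule lands_shift[OF t]) (use i in simp)
  have "(THE t. lands C l (i + l) t) = shift s"
    using t s lands_unique by blast
  then have "entr T i = map_sum id (\<lambda>t. t - l) (shift s)"
    by (simp add: trace_romc_def)
  then have "entr T i = s" by (cases s) auto
  then show "lands C l (i + l) (shift (entr T i))" "entr T i \<in> targets T" using t s by auto
qed

text \<open>The landing relation is a 0/1 matrix whose rows have at most one entry 1. The row of a
  fed-back exit caught in a loop is zero.\<close>

lemma sum_lands:
  fixes X :: "'q + nat \<Rightarrow> 'a::semiring_1"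
  shows "lands C l k (shift t) \<Longrightarrow> t \<in> targets T \<Longrightarrow>
      (\<Sum>s\<in>targets T. of_bool (lands C l k (shift s)) * X s) = X t"
    and "\<nexists>t. lands C l k t \<Longrightarrow> (\<Sum>s\<in>targets T. of_bool (lands C l k (shift s)) * X s) = 0"
proof -
  assume t: "lands C l k (shift t)" "t \<in> targets T"
  have "lands C l k (shift s) \<longleftrightarrow> t = s" for s
    using lands_unique[OF t(1), of "shift s"] t(1) by (auto simp: inj_shift)
  then show "(\<Sum>s\<in>targets T. of_bool (lands C l k (shift s)) * X s) = X t"
    using sum_of_bool_eq[OF finite_T t(2), of X] by simp
qed auto

lemma sum_prec:
  fixes f :: "nat \<Rightarrow> 'a::semiring_1"
  shows "(\<Sum>k\<in>prec C l t. f k) = (\<Sum>k<l. f k * of_bool (lands C l k t))"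
proof -
  have prec: "prec C l t = {k \<in> {..<l}. lands C l k t}" by (auto simp: prec_def)
  show ?thesis
    unfolding prec sum.inter_filter[OF finite_lessThan] by (intro sum.cong refl) simp
qed

lemma submc_trace: "submc T"
proof -
  have nonneg: "prob T q s \<ge> 0" if "q \<in> pos C" "s \<in> targets T" for q s
    unfolding prob_T using that CD(3) by (auto intro!: add_nonneg_nonneg sum_nonneg simp: prec_def)
  have "(\<Sum>s\<in>targets T. prob T q s) \<le> 1" if q: "q \<in> pos C" for q
  proof -
    \<comment> \<open>Redirecting a fed-back exit to its landing point cannot increase mass.\<close>
    have le_1: "(\<Sum>s\<in>targets T. of_bool (lands C l k (shift s)) * 1) \<le> (1::real)" if k: "k < l" for k
    proof (cases "\<exists>t. lands C l k t")
      case True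
      then obtain t where t: "lands C l k t" by blast
      obtain s where "s \<in> targets T" "t = shift s" by (rule lands_shift[OF t]) (use k in simp)
      then show ?thesis using sum_lands(1)[of k s "\<lambda>_. 1::real"] t by simp
    next
      case False
      then show ?thesis using sum_lands(2)[of k "\<lambda>_. 1::real"] by simp
    qed
    have "(\<Sum>s\<in>targets T. prob T q s) = (\<Sum>s\<in>targets T. prob C q (shift s)) +
        (\<Sum>k<l. prob C q (Inr k) * (\<Sum>s\<in>targets T. of_bool (lands C l k (shift s)) * 1))"
      unfolding prob_T sum_prec sum.distrib sum_distrib_left by (subst sum.swap) simp
    also have "\<dots> \<le> (\<Sum>s\<in>targets T. prob C q (shift s)) + (\<Sum>k<l. prob C q (Inr k) * 1)"
      using q CD(3) by (intro add_left_mono sum_mono mult_left_mono le_1) auto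
    also have "\<dots> \<le> 1" using CD(4)[OF q] by (simp add: sum_targets_C)
    finally show ?thesis .
  qed
  then show ?thesis
    using CD(1,5) entr_T(2) nonneg by (simp add: submc_def)
qed

lemma wt_T:
  assumes q: "q \<in> pos C" and s: "s \<in> targets T"
  shows "wt T (Inl q) s = wt C (Inl q) (shift s) +
    (\<Sum>k<l. wt C (Inl q) (Inr k) * of_bool (lands C l k (shift s)))"
proof -
  have nn: "prob C q (shift s) \<ge> 0" "\<And>k. k < l \<Longrightarrow> prob C q (Inr k) \<ge> 0" "rwd C q \<ge> 0"
    using CD(3,5) q s by auto
  have "(\<Sum>k<l. wt C (Inl q) (Inr k) * of_bool (lands C l k (shift s))) =
      (\<Sum>k\<in>prec C l (shift s). wt C (Inl q) (Inr k))"
    by (simp only: sum_prec)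
  also have "\<dots> = dn (\<Sum>k\<in>prec C l (shift s). prob C q (Inr k))
      ((\<Sum>k\<in>prec C l (shift s). prob C q (Inr k)) * rwd C q)"
    unfolding wt_simps sum_distrib_right using nn by (intro dn_sum) (auto simp: prec_def)
  finally have *: "(\<Sum>k<l. wt C (Inl q) (Inr k) * of_bool (lands C l k (shift s))) =
      dn (\<Sum>k\<in>prec C l (shift s). prob C q (Inr k))
      ((\<Sum>k\<in>prec C l (shift s). prob C q (Inr k)) * rwd C q)" .
  have "(\<Sum>k\<in>prec C l (shift s). prob C q (Inr k)) \<ge> 0"
    using nn by (auto intro!: sum_nonneg simp: prec_def)
  then show ?thesis
    unfolding * unfolding wt_simps prob_T T_simps using nn by (subst dn_add) (auto simp: distrib_right)
qed

lemma sum_wt_T: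
  assumes q: "q \<in> pos C"
  shows "(\<Sum>s\<in>targets T. wt T (Inl q) s * X s) = (\<Sum>s\<in>targets T. wt C (Inl q) (shift s) * X s) +
    (\<Sum>k<l. wt C (Inl q) (Inr k) * (\<Sum>s\<in>targets T. of_bool (lands C l k (shift s)) * X s))"
proof -
  have "(\<Sum>s\<in>targets T. wt T (Inl q) s * X s) = (\<Sum>s\<in>targets T. wt C (Inl q) (shift s) * X s +
      (\<Sum>k<l. wt C (Inl q) (Inr k) * of_bool (lands C l k (shift s))) * X s)"
    by (intro sum.cong refl) (simp only: wt_T[OF q] distrib_right)
  also have "\<dots> = (\<Sum>s\<in>targets T. wt C (Inl q) (shift s) * X s) +
    (\<Sum>k<l. wt C (Inl q) (Inr k) * (\<Sum>s\<in>targets T. of_bool (lands C l k (shift s)) * X s))"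
    unfolding sum.distrib sum_distrib_left sum_distrib_right
    by (subst sum.swap) (simp only: mult.assoc)
  finally show ?thesis .
qed

text \<open>A feedback wire is a step of weight 1, with no reward. On a closed loop of wires the
  equations admit every constant; minimality selects 0, in agreement with \<open>prec\<close>, which
  ignores exits that never land.\<close>

definition loop :: "nat \<Rightarrow> 'q + nat \<Rightarrow> dnum" where
  "loop j = sol (targets C)
     (\<lambda>u s. case u of Inl q \<Rightarrow> wt C (Inl q) s | Inr k \<Rightarrow> of_bool (k < l \<and> entr C k = s))
     (bnd (\<lambda>k. of_bool (k = l + j)))"

lemma loop_Inl: "q \<in> pos C \<Longrightarrow> loop j (Inl q) = (\<Sum>s\<in>targets C. wt C (Inl q) s * loop j s)"
  unfolding loop_def by (subst sol_unfold) (auto simp del: wt_simps)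

lemma loop_entr: "k < l \<Longrightarrow> loop j (Inr k) = loop j (entr C k)"
proof -
  assume k: "k < l"
  then have "loop j (Inr k) = (\<Sum>s\<in>targets C. of_bool (entr C k = s) * loop j s)"
    unfolding loop_def by (subst sol_unfold) auto
  then show ?thesis using sum_of_bool_eq[OF CD(6), of "entr C k"] CD(2) k by simp
qed

lemma loop_exit: "k < n \<Longrightarrow> loop j (Inr (l + k)) = of_bool (k = j)"
  unfolding loop_def by (subst sol_unfold) auto

lemma loop_least:
  assumes "\<And>q. q \<in> pos C \<Longrightarrow> (\<Sum>s\<in>targets C. wt C (Inl q) s * Y s) \<le> Y (Inl q)"
    and "\<And>k. k < l \<Longrightarrow> Y (entr C k) \<le> Y (Inr k)"
    and "\<And>k. k < n \<Longrightarrow> of_bool (k = j) \<le> Y (Inr (l + k))"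
  shows "loop j u \<le> Y u"
  unfolding loop_def
proof (rule sol_least)
  fix u assume u: "u \<in> targets C"
  show "bnd (\<lambda>k. of_bool (k = l + j)) u + (\<Sum>s\<in>targets C. (case u of Inl q \<Rightarrow> wt C (Inl q) s
      | Inr k \<Rightarrow> of_bool (k < l \<and> entr C k = s)) * Y s) \<le> Y u"
  proof (cases u)
    case (Inl q)
    then show ?thesis using assms(1) u by (simp del: wt_simps)
  next
    case (Inr k)
    show ?thesis
    proof (cases "k < l")
      case True
      then have "(\<Sum>s\<in>targets C. of_bool (entr C k = s) * Y s) = Y (entr C k)"
        using CD(2) by (intro sum_of_bool_eq CD(6)) auto
      then show ?thesis using assms(2)[OF True] Inr True by simp
    next
      case False
      then show ?thesis using assms(3)[of "k - l"] u Inr by auto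
    qed
  qed
qed

lemma loop_lands: "lands C l i t \<Longrightarrow> loop j (entr C i) = loop j t"
  by (induction rule: lands.induct) (simp_all add: loop_entr)

text \<open>Elimination of the exits in [l]. Each of them has the value of its landing point, so
  substituting these values into the rows of the positions gives the rows of the traced
  chain.\<close>

lemma reach_T:
  assumes s: "s \<in> targets T"
  shows "reach T j s = loop j (shift s)"
proof (rule antisym)
  show "reach T j s \<le> loop j (shift s)"
    unfolding reach_def
  proof (rule val_least)
    fix k assume "k < outs T"
    then show "of_bool (k = j) \<le> loop j (shift (Inr k))"
      using loop_exit[of k j] by (simp add: add.commute)
  next
    fix q assume "q \<in> pos T"
    then have q: "q \<in> pos C" by simp
    have le: "(\<Sum>s\<in>targets T. of_bool (lands C l k (shift s)) * loop j (shift s)) \<le> loop j (Inr k)"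
      if k: "k < l" for k
    proof (cases "\<exists>t. lands C l k t")
      case True
      then obtain t where t: "lands C l k t" by blast
      obtain s where "s \<in> targets T" "t = shift s" by (rule lands_shift[OF t]) (use k in simp)
      then show ?thesis
        using sum_lands(1)[of k s "\<lambda>s. loop j (shift s)"] t loop_lands[OF t] loop_entr[OF k] by simp
    next
      case False
      then show ?thesis using sum_lands(2)[of k "\<lambda>s. loop j (shift s)"] by simp
    qed
    have "(\<Sum>s\<in>targets T. wt T (Inl q) s * loop j (shift s)) \<le>
        (\<Sum>s\<in>targets T. wt C (Inl q) (shift s) * loop j (shift s)) + (\<Sum>k<l. wt C (Inl q) (Inr k) * loop j (Inr k))"
      unfolding sum_wt_T[OF q] by (intro add_left_mono sum_mono mult_left_mono le) auto
    also have "\<dots> = loop j (Inl q)"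
      unfolding loop_Inl[OF q] sum_targets_C ..
    finally show "(\<Sum>s\<in>targets T. wt T (Inl q) s * loop j (shift s)) \<le> loop j (shift (Inl q))"
      by simp
  qed
next
  \<comment> \<open>\<open>Z k\<close> is the solution of the traced chain at the landing point of
    \<open>k\<close>, and 0 if the chain from \<open>k\<close> never lands. It is constant along
    wires, so the extended \<open>Y\<close> respects the feedback equations.\<close>
  define Z where "Z k = (\<Sum>s\<in>targets T. of_bool (lands C l k (shift s)) * reach T j s)" for k
  define Y where "Y u = (case u of Inl q \<Rightarrow> reach T j (Inl q)
    | Inr k \<Rightarrow> if k < l then Z k else reach T j (Inr (k - l)))" for u
  have Y_shift: "Y (shift s) = reach T j s" for s by (cases s) (auto simp: Y_def)
  have Y_loop: "Y (Inr k) = Z k" if "k < l" for k using that by (simp add: Y_def)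
  have "loop j (shift s) \<le> Y (shift s)"
  proof (rule loop_least)
    fix q assume q: "q \<in> pos C"
    have "(\<Sum>s\<in>targets C. wt C (Inl q) s * Y s) = (\<Sum>s\<in>targets T. wt T (Inl q) s * reach T j s)"
      unfolding sum_targets_C sum_wt_T[OF q] Y_shift Z_def[symmetric]
      by (simp add: Y_loop del: wt_simps)
    also have "\<dots> = Y (Inl q)" using reach_Inl[of q T j] q by (simp add: Y_def del: wt_simps)
    finally show "(\<Sum>s\<in>targets C. wt C (Inl q) s * Y s) \<le> Y (Inl q)" by simp
  next
    fix k assume k: "k < l"
    then have "entr C k \<in> targets C" using CD(2) by simp
    then show "Y (entr C k) \<le> Y (Inr k)"
    proof (cases rule: targets_cases)
      case (1 k')
      then show ?thesis
        using k by (simp add: Y_loop Z_def lands_step_iff[OF 1(2,1)])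
    next
      case (2 s)
      then have "lands C l k (shift s)" by (cases s) (auto intro!: lands.stop)
      then show ?thesis
        using sum_lands(1)[of k s "reach T j"] 2 k by (simp add: Y_loop Y_shift Z_def)
    qed
  qed (simp add: Y_def)
  then show "loop j (shift s) \<le> reach T j s" by (simp add: Y_shift)
qed

lemma reach_T_entr:
  assumes i: "i < m"
  shows "reach T j (entr T i) = loop j (entr C (i + l))"
proof -
  have "reach T j (entr T i) = loop j (shift (entr T i))" by (rule reach_T[OF entr_T(2)[OF i]])
  also have "\<dots> = loop j (entr C (i + l))" by (rule loop_lands[OF entr_T(1)[OF i], symmetric])
  finally show ?thesis .
qed

text \<open>Once the values at the exits are frozen as boundary data, only the system of
  \<open>C\<close> remains. The bound of \<open>val\<close> by \<open>loop\<close> comes first,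
  since it is needed to check the feedback equations for \<open>val\<close> in the converse
  direction.\<close>

lemma loop_eq_val: "loop j s = val C (\<lambda>k. loop j (Inr k)) s"
proof -
  define b where "b k = loop j (Inr k)" for k
  have ge: "val C b s \<le> loop j s" for s
  proof (rule val_least)
    fix q assume "q \<in> pos C"
    then show "(\<Sum>s\<in>targets C. wt C (Inl q) s * loop j s) \<le> loop j (Inl q)"
      using loop_Inl[of q j] by simp
  qed (simp add: b_def)
  have "loop j s \<le> val C b s"
  proof (rule loop_least)
    fix q assume "q \<in> pos C"
    then show "(\<Sum>s\<in>targets C. wt C (Inl q) s * val C b s) \<le> val C b (Inl q)"
      using val_Inl[of q C b] by simp
  next
    fix k assume k: "k < l"
    have "val C b (entr C k) \<le> loop j (entr C k)" by (rule ge)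
    also have "\<dots> = val C b (Inr k)" using k loop_entr[OF k, of j] by (simp add: b_def)
    finally show "val C b (entr C k) \<le> val C b (Inr k)" .
  next
    fix k assume "k < n"
    then show "of_bool (k = j) \<le> val C b (Inr (l + k))" using loop_exit[of k j] by (simp add: b_def)
  qed
  then have "loop j s = val C b s" using ge by (intro antisym)
  then show ?thesis by (simp add: b_def[abs_def])
qed

lemma sum_exits:
  assumes "j < n" "\<And>k. k < n \<Longrightarrow> b (l + k) = (of_bool (k = j) :: dnum)"
  shows "(\<Sum>k<l + n. b k * f k) = (\<Sum>k<l. b k * f k) + f (l + j)"
proof -
  have "(\<Sum>k<n. b (l + k) * f (l + k)) = (\<Sum>k<n. of_bool (j = k) * f (l + k))"
    by (intro sum.cong) (auto simp: assms(2))
  then show ?thesis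
    using sum_of_bool_eq[of "{..<n}" j "\<lambda>k. f (l + k)"] assms(1) by (simp add: sum_lessThan_add)
qed

lemma loop_eq_sum:
  assumes "j < n"
  shows "loop j s = (\<Sum>k<l. loop j (Inr k) * reach C k s) + reach C (l + j) s"
proof -
  have "loop j s = (\<Sum>k<l + n. loop j (Inr k) * reach C k s)"
    using loop_eq_val[of j s] unfolding val_eq_sum_reach by simp
  also have "\<dots> = (\<Sum>k<l. loop j (Inr k) * reach C k s) + reach C (l + j) s"
    using assms loop_exit by (rule sum_exits)
  finally show ?thesis .
qed

text \<open>The system that remains on the l fed-back exits: its coefficients are passages through
  \<open>C\<close> from an entrance in [l] back to an exit in [l], its constant term the passages
  leaving at exit \<open>l + j\<close>. Its Neumann series is the sum of B^d C.\<close>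

definition inner :: "nat \<Rightarrow> nat \<Rightarrow> dnum" where
  "inner j = sol {..<l} (\<lambda>k k'. reach C k' (entr C k)) (\<lambda>k. reach C (l + j) (entr C k))"

lemma loop_Inr:
  assumes j: "j < n" and k: "k < l"
  shows "loop j (Inr k) = inner j k"
proof (rule antisym)
  show "inner j k \<le> loop j (Inr k)"
    unfolding inner_def
  proof (rule sol_least)
    fix k assume "k \<in> {..<l}"
    then have "loop j (Inr k) = loop j (entr C k)" by (simp add: loop_entr)
    also have "\<dots> = (\<Sum>k'<l. loop j (Inr k') * reach C k' (entr C k)) + reach C (l + j) (entr C k)"
      by (rule loop_eq_sum[OF j])
    finally show "reach C (l + j) (entr C k) + (\<Sum>k'<l. reach C k' (entr C k) * loop j (Inr k')) \<le> loop j (Inr k)"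
      by (simp add: ac_simps)
  qed
  \<comment> \<open>Extending \<open>inner\<close> through \<open>C\<close> by \<open>val\<close>
    gives a candidate on all targets; the equation of \<open>inner\<close> is exactly the feedback
    condition for it.\<close>
  define b where "b k = (if k < l then inner j k else of_bool (k = l + j))" for k
  have "loop j (Inr k) \<le> val C b (Inr k)"
  proof (rule loop_least)
    fix k assume k: "k < l"
    have "val C b (entr C k) = (\<Sum>k'<l. b k' * reach C k' (entr C k)) + reach C (l + j) (entr C k)"
      unfolding val_eq_sum_reach outs using j by (rule sum_exits) (simp add: b_def)
    also have "\<dots> = reach C (l + j) (entr C k) + (\<Sum>k'<l. reach C k' (entr C k) * inner j k')"
      by (simp add: b_def ac_simps)
    also have "\<dots> = inner j k"
      unfolding inner_def using k by (subst (2) sol_unfold) simp_all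
    finally show "val C b (entr C k) \<le> val C b (Inr k)" using k by (simp add: b_def)
  qed (simp_all add: val_Inl b_def del: wt_simps)
  then show "loop j (Inr k) \<le> inner j k" using k by (simp add: b_def)
qed

lemma reach_trace:
  assumes "i < m" "j < n"
  shows "reach T j (entr T i) = reach C (l + j) (entr C (l + i)) +
    (\<Sum>k<l. reach C k (entr C (l + i)) * inner j k)"
proof -
  have "reach T j (entr T i) = loop j (entr C (l + i))"
    using reach_T_entr[OF assms(1)] by (simp add: add.commute)
  also have "\<dots> = (\<Sum>k<l. inner j k * reach C k (entr C (l + i))) + reach C (l + j) (entr C (l + i))"
    unfolding loop_eq_sum[OF assms(2), of "entr C (l + i)"] by (simp add: loop_Inr[OF assms(2)])
  finally show ?thesis by (simp add: ac_simps)
qed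

section \<open>The trace series as a series of dual number matrices\<close>

abbreviation "Ap \<equiv> blkA l m (fst (sem C))"
abbreviation "Ar \<equiv> blkA l m (snd (sem C))"
abbreviation "Bp \<equiv> blkB l (fst (sem C))"
abbreviation "Br \<equiv> blkB l (snd (sem C))"
abbreviation "Cp \<equiv> blkC l n (fst (sem C))"
abbreviation "Cr \<equiv> blkC l n (snd (sem C))"
abbreviation "A2 \<equiv> four_block_mat Ap Ar (0\<^sub>m 0 l) (0\<^sub>m 0 l)"
abbreviation "B2 \<equiv> four_block_mat Bp Br (0\<^sub>m l l) Bp"
abbreviation "C2 \<equiv> Cr @\<^sub>r Cp"

lemma carrier:
  "Ap \<in> carrier_mat m l" "Ar \<in> carrier_mat m l" "Bp \<in> carrier_mat l l" "Br \<in> carrier_mat l l"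
  "Cp \<in> carrier_mat l n" "Cr \<in> carrier_mat l n"
  "A2 \<in> carrier_mat m (l + l)" "B2 \<in> carrier_mat (l + l) (l + l)" "C2 \<in> carrier_mat (l + l) n"
proof -
  show c: "Ap \<in> carrier_mat m l" "Ar \<in> carrier_mat m l" "Bp \<in> carrier_mat l l" "Br \<in> carrier_mat l l"
    "Cp \<in> carrier_mat l n" "Cr \<in> carrier_mat l n"
    by (simp_all add: blkA_def blkB_def blkC_def)
  show "A2 \<in> carrier_mat m (l + l)" "B2 \<in> carrier_mat (l + l) (l + l)" "C2 \<in> carrier_mat (l + l) n"
    using four_block_carrier_mat[OF c(1), of "0\<^sub>m 0 l" 0 l Ar "0\<^sub>m 0 l"]
      four_block_carrier_mat[OF c(3) c(3)] carrier_append_rows[OF c(6) c(5)]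
    by simp_all
qed

lemma entries:
  shows "i < m \<Longrightarrow> k < l \<Longrightarrow> Ap $$ (i, k) \<ge> 0 \<and> Ar $$ (i, k) \<ge> 0 \<and>
      reach C k (entr C (l + i)) = dn (Ap $$ (i, k)) (Ar $$ (i, k))"
    and "k < l \<Longrightarrow> k' < l \<Longrightarrow> Bp $$ (k, k') \<ge> 0 \<and> Br $$ (k, k') \<ge> 0 \<and>
      reach C k' (entr C k) = dn (Bp $$ (k, k')) (Br $$ (k, k'))"
    and "k < l \<Longrightarrow> j < n \<Longrightarrow> Cp $$ (k, j) \<ge> 0 \<and> Cr $$ (k, j) \<ge> 0 \<and>
      reach C (l + j) (entr C k) = dn (Cp $$ (k, j)) (Cr $$ (k, j))"
proof -
  show "Ap $$ (i, k) \<ge> 0 \<and> Ar $$ (i, k) \<ge> 0 \<and>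
      reach C k (entr C (l + i)) = dn (Ap $$ (i, k)) (Ar $$ (i, k))" if "i < m" "k < l"
    using sem_entry[OF submc, of "l + i" k] that by (simp add: blkA_def)
  show "Bp $$ (k, k') \<ge> 0 \<and> Br $$ (k, k') \<ge> 0 \<and>
      reach C k' (entr C k) = dn (Bp $$ (k, k')) (Br $$ (k, k'))" if "k < l" "k' < l"
    using sem_entry[OF submc, of k k'] that by (simp add: blkB_def)
  show "Cp $$ (k, j) \<ge> 0 \<and> Cr $$ (k, j) \<ge> 0 \<and>
      reach C (l + j) (entr C k) = dn (Cp $$ (k, j)) (Cr $$ (k, j))" if "k < l" "j < n"
    using sem_entry[OF submc, of k "l + j"] that by (simp add: blkC_def)
qed

text \<open>The block matrix \<open>B2\<close> represents multiplication by Bp + Br \<epsilon>,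
  acting on columns with the \<epsilon>-coefficient on top and the base below. The claim that the
  lower half of the column stays equal to the probability part is carried along because the
  induction for the upper half consumes it.\<close>

lemma orbit_eq_dn:
  assumes j: "j < n" and "k < l"
  shows "(Bp ^\<^sub>m d * Cp) $$ (k, j) \<ge> 0 \<and> (B2 ^\<^sub>m d * C2) $$ (k, j) \<ge> 0 \<and>
    (B2 ^\<^sub>m d * C2) $$ (l + k, j) = (Bp ^\<^sub>m d * Cp) $$ (k, j) \<and>
    orbit {..<l} (\<lambda>k k'. reach C k' (entr C k)) (\<lambda>k. reach C (l + j) (entr C k)) d k =
      dn ((Bp ^\<^sub>m d * Cp) $$ (k, j)) ((B2 ^\<^sub>m d * C2) $$ (k, j))"
  using \<open>k < l\<close>
proof (induction d arbitrary: k)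
  case 0
  have "B2 ^\<^sub>m 0 * C2 = C2" "Bp ^\<^sub>m 0 * Cp = Cp"
    by (simp_all only: pow_mat.simps carrier_matD(1)[OF carrier(8)] carrier_matD(1)[OF carrier(3)]
        left_mult_one_mat[OF carrier(9)] left_mult_one_mat[OF carrier(5)])
  moreover have "C2 $$ (k, j) = Cr $$ (k, j)" "C2 $$ (l + k, j) = Cp $$ (k, j)"
    using 0 j carrier_matD[OF carrier(5)] carrier_matD[OF carrier(6)] by (simp_all add: append_rows_def)
  ultimately show ?case using entries(3)[OF 0 j] by simp
next
  case (Suc d)
  let ?Y = "Bp ^\<^sub>m d * Cp" and ?Z = "B2 ^\<^sub>m d * C2"
  let ?B = "\<lambda>k k'. reach C k' (entr C k)" and ?c = "\<lambda>k. reach C (l + j) (entr C k)"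
  have Y: "?Y \<in> carrier_mat l n" and Z: "?Z \<in> carrier_mat (l + l) n"
    by (rule mult_carrier_mat[OF pow_carrier_mat[OF carrier(3)] carrier(5)],
        rule mult_carrier_mat[OF pow_carrier_mat[OF carrier(8)] carrier(9)])
  have Y': "Bp ^\<^sub>m Suc d * Cp = Bp * ?Y"
    unfolding pow_mat_Suc_left[OF carrier(3)]
    by (rule assoc_mult_mat[OF carrier(3) pow_carrier_mat[OF carrier(3)] carrier(5)])
  have Z': "B2 ^\<^sub>m Suc d * C2 = B2 * ?Z"
    unfolding pow_mat_Suc_left[OF carrier(8)]
    by (rule assoc_mult_mat[OF carrier(8) pow_carrier_mat[OF carrier(8)] carrier(9)])
  have Bdim: "dim_row Bp = l" "dim_col Bp = l" "dim_row Br = l" "dim_col Br = l"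
    by (simp_all add: blkB_def)
  have Y_k: "(Bp ^\<^sub>m Suc d * Cp) $$ (k, j) = (\<Sum>k'<l. Bp $$ (k, k') * ?Y $$ (k', j))"
    unfolding Y' using carrier(3) Y Suc.prems j by (simp only: index_mult_mat_sum carrier_matD)
  have Z_row: "(B2 ^\<^sub>m Suc d * C2) $$ (k, j) =
      (\<Sum>k'<l. B2 $$ (k, k') * ?Z $$ (k', j)) + (\<Sum>k'<l. B2 $$ (k, l + k') * ?Z $$ (l + k', j))"
    if "k < l + l" for k
    unfolding Z'
    using carrier(8) Z that j by (simp only: index_mult_mat_sum carrier_matD sum_lessThan_add)
  have B2_entries: "B2 $$ (k, k') = Bp $$ (k, k')" "B2 $$ (k, l + k') = Br $$ (k, k')"
    "B2 $$ (l + k, k') = 0" "B2 $$ (l + k, l + k') = Bp $$ (k, k')" if "k' < l" for k'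
    using that Suc.prems by (simp_all add: Bdim)
  have IH: "?Y $$ (k', j) \<ge> 0" "?Z $$ (k', j) \<ge> 0" "?Z $$ (l + k', j) = ?Y $$ (k', j)"
    "orbit {..<l} ?B ?c d k' = dn (?Y $$ (k', j)) (?Z $$ (k', j))" if "k' < l" for k'
    using Suc.IH[OF that] by blast+
  have B: "Bp $$ (k, k') \<ge> 0" "Br $$ (k, k') \<ge> 0"
    "reach C k' (entr C k) = dn (Bp $$ (k, k')) (Br $$ (k, k'))" if "k' < l" for k'
    using entries(2)[OF Suc.prems that] by blast+
  have Z_k: "(B2 ^\<^sub>m Suc d * C2) $$ (k, j) =
      (\<Sum>k'<l. Bp $$ (k, k') * ?Z $$ (k', j) + Br $$ (k, k') * ?Y $$ (k', j))"
    using Z_row[of k] Suc.prems by (simp add: B2_entries IH(3) sum.distrib)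
  have Z_lk: "(B2 ^\<^sub>m Suc d * C2) $$ (l + k, j) = (Bp ^\<^sub>m Suc d * Cp) $$ (k, j)"
    unfolding Y_k using Z_row[of "l + k"] Suc.prems by (simp add: B2_entries IH(3))
  have "orbit {..<l} ?B ?c (Suc d) k =
      (\<Sum>k'<l. dn (Bp $$ (k, k')) (Br $$ (k, k')) * dn (?Y $$ (k', j)) (?Z $$ (k', j)))"
    by (simp add: B(3) IH(4))
  also have "\<dots> = (\<Sum>k'<l. dn (Bp $$ (k, k') * ?Y $$ (k', j))
      (Bp $$ (k, k') * ?Z $$ (k', j) + Br $$ (k, k') * ?Y $$ (k', j)))"
    by (intro sum.cong refl dn_mult) (simp_all add: B(1,2) IH(1,2))
  also have "\<dots> = dn ((Bp ^\<^sub>m Suc d * Cp) $$ (k, j)) ((B2 ^\<^sub>m Suc d * C2) $$ (k, j))"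
    unfolding Y_k Z_k by (intro dn_sum) (simp_all add: B(1,2) IH(1,2))
  finally have orb: "orbit {..<l} ?B ?c (Suc d) k =
      dn ((Bp ^\<^sub>m Suc d * Cp) $$ (k, j)) ((B2 ^\<^sub>m Suc d * C2) $$ (k, j))" .
  have "(Bp ^\<^sub>m Suc d * Cp) $$ (k, j) \<ge> 0" "(B2 ^\<^sub>m Suc d * C2) $$ (k, j) \<ge> 0"
    unfolding Y_k Z_k by (intro sum_nonneg; simp add: B(1,2) IH(1,2))+
  then show ?case using Z_lk orb by blast
qed

text \<open>The row (Ap Ar) pairs Ap with the \<epsilon>-half and Ar with the base half of the
  column: the Leibniz rule for the \<epsilon>-coefficient of A B^d C.\<close>

lemma tr_term_eq_dn:
  assumes i: "i < m" and j: "j < n"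
  shows "tr_term_p l m n (sem C) d $$ (i, j) \<ge> 0" "tr_term_r l m n (sem C) d $$ (i, j) \<ge> 0"
    "(\<Sum>k<l. reach C k (entr C (l + i)) *
        orbit {..<l} (\<lambda>k k'. reach C k' (entr C k)) (\<lambda>k. reach C (l + j) (entr C k)) d k) =
      dn (tr_term_p l m n (sem C) d $$ (i, j)) (tr_term_r l m n (sem C) d $$ (i, j))"
proof -
  let ?Y = "Bp ^\<^sub>m d * Cp" and ?Z = "B2 ^\<^sub>m d * C2"
  have Y: "?Y \<in> carrier_mat l n" and Z: "?Z \<in> carrier_mat (l + l) n"
    by (rule mult_carrier_mat[OF pow_carrier_mat[OF carrier(3)] carrier(5)],
        rule mult_carrier_mat[OF pow_carrier_mat[OF carrier(8)] carrier(9)])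
  have Adim: "dim_row Ap = m" "dim_col Ap = l" "dim_row Ar = m" "dim_col Ar = l"
    by (simp_all add: blkA_def)
  have nn: "?Y $$ (k, j) \<ge> 0" "?Z $$ (k, j) \<ge> 0" "Ap $$ (i, k) \<ge> 0" "Ar $$ (i, k) \<ge> 0" if "k < l" for k
    using orbit_eq_dn[OF j that, of d] entries(1)[OF i that] by auto
  have "tr_term_p l m n (sem C) d = Ap * ?Y"
    unfolding tr_term_p_def
    by (rule assoc_mult_mat[OF carrier(1) pow_carrier_mat[OF carrier(3)] carrier(5)])
  then have p: "tr_term_p l m n (sem C) d $$ (i, j) = (\<Sum>k<l. Ap $$ (i, k) * ?Y $$ (k, j))"
    using carrier(1) Y i j by (simp only: index_mult_mat_sum carrier_matD)
  have "tr_term_r l m n (sem C) d = A2 * ?Z"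
    unfolding tr_term_r_def
    by (rule assoc_mult_mat[OF carrier(7) pow_carrier_mat[OF carrier(8)] carrier(9)])
  then have "tr_term_r l m n (sem C) d $$ (i, j) = (\<Sum>k<l + l. A2 $$ (i, k) * ?Z $$ (k, j))"
    using carrier(7) Z i j by (simp only: index_mult_mat_sum carrier_matD)
  also have "\<dots> = (\<Sum>k<l. Ap $$ (i, k) * ?Z $$ (k, j) + Ar $$ (i, k) * ?Y $$ (k, j))"
    using i orbit_eq_dn[OF j] by (auto simp: sum_lessThan_add sum.distrib Adim)
  finally have r: "tr_term_r l m n (sem C) d $$ (i, j) =
      (\<Sum>k<l. Ap $$ (i, k) * ?Z $$ (k, j) + Ar $$ (i, k) * ?Y $$ (k, j))" .
  show "tr_term_p l m n (sem C) d $$ (i, j) \<ge> 0" "tr_term_r l m n (sem C) d $$ (i, j) \<ge> 0"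
    unfolding p r using nn by (auto intro!: sum_nonneg)
  have "(\<Sum>k<l. reach C k (entr C (l + i)) *
        orbit {..<l} (\<lambda>k k'. reach C k' (entr C k)) (\<lambda>k. reach C (l + j) (entr C k)) d k) =
      (\<Sum>k<l. dn (Ap $$ (i, k)) (Ar $$ (i, k)) * dn (?Y $$ (k, j)) (?Z $$ (k, j)))"
    using orbit_eq_dn[OF j] entries(1)[OF i] by simp
  also have "\<dots> = (\<Sum>k<l. dn (Ap $$ (i, k) * ?Y $$ (k, j))
      (Ap $$ (i, k) * ?Z $$ (k, j) + Ar $$ (i, k) * ?Y $$ (k, j)))"
    using nn by (intro sum.cong refl dn_mult) auto
  also have "\<dots> = dn (tr_term_p l m n (sem C) d $$ (i, j)) (tr_term_r l m n (sem C) d $$ (i, j))"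
    unfolding p r using nn by (intro dn_sum) auto
  finally show "(\<Sum>k<l. reach C k (entr C (l + i)) *
        orbit {..<l} (\<lambda>k k'. reach C k' (entr C k)) (\<lambda>k. reach C (l + j) (entr C k)) d k) =
      dn (tr_term_p l m n (sem C) d $$ (i, j)) (tr_term_r l m n (sem C) d $$ (i, j))" .
qed

lemma tr_series:
  assumes i: "i < m" and j: "j < n"
  shows "summable (\<lambda>d. tr_term_p l m n (sem C) d $$ (i, j))"
    and "summable (\<lambda>d. tr_term_r l m n (sem C) d $$ (i, j))"
    and "reach T j (entr T i) = reach C (l + j) (entr C (l + i)) +
      dn (\<Sum>d. tr_term_p l m n (sem C) d $$ (i, j)) (\<Sum>d. tr_term_r l m n (sem C) d $$ (i, j))"
proof -
  let ?B = "\<lambda>k k'. reach C k' (entr C k)" and ?c = "\<lambda>k. reach C (l + j) (entr C k)"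
  define z where "z = (\<Sum>k<l. reach C k (entr C (l + i)) * inner j k)"
  have "z = dsup (\<lambda>N. \<Sum>k<l. reach C k (entr C (l + i)) * iter {..<l} ?B ?c N k)"
    unfolding z_def inner_def sol_def
    by (simp add: dsup_sum dsup_cmult incseq_iter incseq_dnum_cmult)
  also have "(\<lambda>N. \<Sum>k<l. reach C k (entr C (l + i)) * iter {..<l} ?B ?c N k) =
      (\<lambda>N. \<Sum>d<N. dn (tr_term_p l m n (sem C) d $$ (i, j)) (tr_term_r l m n (sem C) d $$ (i, j)))"
  proof
    fix N
    have "(\<Sum>k<l. reach C k (entr C (l + i)) * iter {..<l} ?B ?c N k) =
        (\<Sum>k<l. \<Sum>d<N. reach C k (entr C (l + i)) * orbit {..<l} ?B ?c d k)"
      by (simp add: iter_eq_sum_orbit sum_distrib_left)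
    also have "\<dots> = (\<Sum>d<N. \<Sum>k<l. reach C k (entr C (l + i)) * orbit {..<l} ?B ?c d k)"
      by (rule sum.swap)
    finally show "(\<Sum>k<l. reach C k (entr C (l + i)) * iter {..<l} ?B ?c N k) =
        (\<Sum>d<N. dn (tr_term_p l m n (sem C) d $$ (i, j)) (tr_term_r l m n (sem C) d $$ (i, j)))"
      by (simp only: tr_term_eq_dn(3)[OF i j])
  qed
  finally have z: "z = dsup (\<lambda>N. \<Sum>d<N. dn (tr_term_p l m n (sem C) d $$ (i, j))
      (tr_term_r l m n (sem C) d $$ (i, j)))" .
  have T: "reach T j (entr T i) = reach C (l + j) (entr C (l + i)) + z"
    unfolding z_def by (rule reach_trace[OF i j])
  moreover have "reach T j (entr T i) = dn (RPr T i j) (ERw T i j)"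
    using i j by (intro reach_eq_dn[OF submc_trace]) auto
  \<comment> \<open>The series is a summand of the value of the traced chain, whose coefficients are
    real numbers, so it is finite; no estimate on the powers of B is involved.\<close>
  ultimately have "base z \<le> ennreal (RPr T i j)" "eps z \<le> ennreal (ERw T i j)"
    by (metis base_dn base_simps(3) le_iff_add add.commute, metis eps_dn eps_simps(3) le_iff_add add.commute)
  then have "base z < \<infinity>" "eps z < \<infinity>"
    by (auto intro: order_le_less_trans)
  note series = suminf_dnum[OF tr_term_eq_dn(1)[OF i j] tr_term_eq_dn(2)[OF i j] z this]
  show "summable (\<lambda>d. tr_term_p l m n (sem C) d $$ (i, j))"
    "summable (\<lambda>d. tr_term_r l m n (sem C) d $$ (i, j))"
    by (fact series(1), fact series(2))
  show "reach T j (entr T i) = reach C (l + j) (entr C (l + i)) +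
      dn (\<Sum>d. tr_term_p l m n (sem C) d $$ (i, j)) (\<Sum>d. tr_term_r l m n (sem C) d $$ (i, j))"
    unfolding T series(3) ..
qed

lemma sem_trace: "sem T = smc_trace l m n (sem C)"
proof (rule sem_eqI[OF submc_trace])
  fix i j assume "i < ins T" "j < outs T"
  then have ij: "i < m" "j < n" by auto
  let ?p = "\<Sum>d. tr_term_p l m n (sem C) d $$ (i, j)" and ?r = "\<Sum>d. tr_term_r l m n (sem C) d $$ (i, j)"
  have e: "fst (sem C) $$ (l + i, l + j) \<ge> 0" "snd (sem C) $$ (l + i, l + j) \<ge> 0"
    "reach C (l + j) (entr C (l + i)) = dn (fst (sem C) $$ (l + i, l + j)) (snd (sem C) $$ (l + i, l + j))"
    using sem_entry[OF submc, of "l + i" "l + j"] ij by auto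
  have s: "?p \<ge> 0" "?r \<ge> 0"
    using tr_series(1,2)[OF ij] tr_term_eq_dn(1,2)[OF ij] by (auto intro!: suminf_nonneg)
  have "reach T j (entr T i) = dn (fst (sem C) $$ (l + i, l + j) + ?p) (snd (sem C) $$ (l + i, l + j) + ?r)"
    using tr_series(3)[OF ij] e s by (simp add: dn_add)
  then show "fst (smc_trace l m n (sem C)) $$ (i, j) \<ge> 0 \<and> snd (smc_trace l m n (sem C)) $$ (i, j) \<ge> 0 \<and>
      reach T j (entr T i) = dn (fst (smc_trace l m n (sem C)) $$ (i, j)) (snd (smc_trace l m n (sem C)) $$ (i, j))"
    using ij e s by (simp add: smc_trace_def)
qed (auto simp: smc_trace_def)

end

section \<open>The functor\<close>

lemma sem_MC_UN2_iso_class: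
  assumes "I \<noteq> {}" "J \<noteq> {}" "\<And>x y. x \<in> I \<Longrightarrow> y \<in> J \<Longrightarrow> submc (F x y)"
    and "\<And>x y. x \<in> I \<Longrightarrow> y \<in> J \<Longrightarrow> sem (F x y) = z"
  shows "sem_MC (\<Union>x\<in>I. \<Union>y\<in>J. iso_class (F x y)) = z"
proof -
  have "(\<Union>x\<in>I. \<Union>y\<in>J. iso_class (F x y)) = (\<Union>a\<in>I \<times> J. iso_class (F (fst a) (snd a)))"
    by fastforce
  also have "sem_MC \<dots> = z" using assms by (intro sem_MC_UN_iso_class) auto
  finally show ?thesis .
qed

lemma sem_MC_Seq:
  assumes X: "X \<in> Hom roMC m n" and Y: "Y \<in> Hom roMC n k"
  shows "sem_MC (Seq roMC X Y) = smc_seq (sem_MC X) (sem_MC Y)"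
proof -
  have "submc (seq_romc C D) \<and> sem (seq_romc C D) = smc_seq (sem_MC X) (sem_MC Y)"
    if CD: "C \<in> X" "D \<in> Y" for C D
  proof -
    have C: "romc m n C" and D: "romc n k D" using HomD(2)[OF X CD(1)] HomD(2)[OF Y CD(2)] .
    note sub = romc_submc[OF C] romc_submc[OF D]
    have "outs C = ins D" using C D by (simp add: romc_def)
    then show ?thesis
      using submc_seq[OF sub] sem_seq[OF sub] HomD(3)[OF X CD(1)] HomD(3)[OF Y CD(2)] by simp
  qed
  then have "sem_MC (\<Union>C\<in>X. \<Union>D\<in>Y. iso_class (seq_romc C D)) = smc_seq (sem_MC X) (sem_MC Y)"
    using HomD(1)[OF X] HomD(1)[OF Y] by (intro sem_MC_UN2_iso_class) auto
  then show ?thesis by (simp add: roMC_def)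
qed

lemma sem_MC_Tensor:
  assumes X: "X \<in> Hom roMC m n" and Y: "Y \<in> Hom roMC m' n'"
  shows "sem_MC (Tensor roMC X Y) = smc_sum (sem_MC X) (sem_MC Y)"
proof -
  have "submc (sum_romc C D) \<and> sem (sum_romc C D) = smc_sum (sem_MC X) (sem_MC Y)"
    if CD: "C \<in> X" "D \<in> Y" for C D
  proof -
    have C: "romc m n C" and D: "romc m' n' D" using HomD(2)[OF X CD(1)] HomD(2)[OF Y CD(2)] .
    note sub = romc_submc[OF C] romc_submc[OF D]
    show ?thesis
      using submc_sum[OF sub] sem_sum[OF sub] HomD(3)[OF X CD(1)] HomD(3)[OF Y CD(2)] by simp
  qed
  then have "sem_MC (\<Union>C\<in>X. \<Union>D\<in>Y. iso_class (sum_romc C D)) = smc_sum (sem_MC X) (sem_MC Y)"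
    using HomD(1)[OF X] HomD(1)[OF Y] by (intro sem_MC_UN2_iso_class) auto
  then show ?thesis by (simp add: roMC_def)
qed

lemma sem_MC_Tr:
  assumes X: "X \<in> Hom roMC (l + m) (l + n)"
  shows "sem_MC (Tr roMC l m n X) = smc_trace l m n (sem_MC X)"
proof -
  have "submc (trace_romc l m n C) \<and> sem (trace_romc l m n C) = smc_trace l m n (sem_MC X)"
    if C: "C \<in> X" for C
  proof -
    interpret feedback C l m n by unfold_locales (rule HomD(2)[OF X C])
    show ?thesis using submc_trace sem_trace HomD(3)[OF X C] by simp
  qed
  then have "sem_MC (\<Union>C\<in>X. iso_class (trace_romc l m n C)) = smc_trace l m n (sem_MC X)"
    using HomD(1)[OF X] by (intro sem_MC_UN_iso_class) auto
  then show ?thesis by (simp add: roMC_def)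
qed

lemma sem_MC_Hom:
  assumes X: "X \<in> Hom roMC m n"
  shows "sem_MC X \<in> smc_hom m n"
proof -
  obtain C where C: "C \<in> X" using HomD(1)[OF X] by blast
  have "romc m n C" by (rule HomD(2)[OF X C])
  then show ?thesis
    using sem_in_smc_hom[OF romc_submc] HomD(3)[OF X C] by (fastforce simp: romc_def)
qed

lemma tr_term_summable:
  assumes X: "X \<in> Hom roMC (l + m) (l + n)" and "i < m" "j < n"
  shows "summable (\<lambda>d. tr_term_p l m n (sem_MC X) d $$ (i, j))"
    and "summable (\<lambda>d. tr_term_r l m n (sem_MC X) d $$ (i, j))"
proof -
  obtain C where C: "C \<in> X" using HomD(1)[OF X] by blast
  interpret feedback C l m n by unfold_locales (rule HomD(2)[OF X C])
  show "summable (\<lambda>d. tr_term_p l m n (sem_MC X) d $$ (i, j))"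
    "summable (\<lambda>d. tr_term_r l m n (sem_MC X) d $$ (i, j))"
    unfolding HomD(3)[OF X C] by (rule tr_series[OF assms(2,3)])+
qed

text \<open>Equations between infinite sums say little if these diverge and take default values, so
  summability is asserted along with functoriality. The clause on
  \<open>sem_MC (iso_class C)\<close> ties the functor on classes over \<open>nat\<close> to chains
  with positions of any type.\<close>

theorem theorem3:
  shows "(\<forall>m n. \<forall>C :: 'q omc. romc m n C \<longrightarrow>
            (\<forall>i<m. \<forall>j<n.
               path_prob C j summable_on paths C i j \<and>
               (\<lambda>ss. path_prob C j ss * path_rwd C ss) summable_on paths C i j) \<and>
            iso_class C \<in> Hom roMC m n \<and> sem_MC (iso_class C) = sem C) \<and>
         (\<forall>l m n. \<forall>X\<in>Hom roMC (l + m) (l + n). \<forall>i<m. \<forall>j<n.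
            summable (\<lambda>d. tr_term_p l m n (sem_MC X) d $$ (i, j)) \<and>
            summable (\<lambda>d. tr_term_r l m n (sem_MC X) d $$ (i, j))) \<and>
         traced_sm_functor roMC SMC sem_MC"
proof (intro conjI allI impI ballI)
  fix m n i j and C :: "'q omc"
  assume C: "romc m n C" and "i < m" "j < n"
  then have "i < ins C" "j < outs C" by (simp_all add: romc_def)
  then show "path_prob C j summable_on paths C i j"
    "(\<lambda>ss. path_prob C j ss * path_rwd C ss) summable_on paths C i j"
    using path_prob_summable path_rwd_summable romc_submc[OF C] by blast+
next
  fix m n and C :: "'q omc"
  assume C: "romc m n C"
  show "iso_class C \<in> Hom roMC m n" by (rule iso_class_in_Hom[OF C])
  show "sem_MC (iso_class C) = sem C" by (rule sem_MC_iso_class[OF romc_submc[OF C]])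
next
  have "sem_MC (Ident roMC n) = Ident SMC n" for n
    using sem_MC_iso_class[OF submc_id] by (simp add: roMC_def SMC_def sem_id)
  moreover have "sem_MC (Swap roMC m n) = Swap SMC m n" for m n
    using sem_MC_iso_class[OF submc_swap] by (simp add: roMC_def SMC_def sem_swap)
  ultimately show "traced_sm_functor roMC SMC sem_MC"
    unfolding traced_sm_functor_def
    by (intro conjI allI ballI)
      (simp_all add: SMC_def sem_MC_Hom sem_MC_Seq sem_MC_Tensor sem_MC_Tr)
qed (rule tr_term_summable; assumption)+

end
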